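(* Let $\xi\to X$ be a complex vector bundle over a space $X$. There are maps \[\xi^{\mathbb{P}}\xrightarrow{p}\xi^{\mathrm{S}}\xrightarrow{q}\xi^{\mathrm{P}}\] that commute with the projections to $X$ and with the inclusions from $\xi$. The map $p$ induces a homeomorphism between $\xi^{\mathrm{S}}$ and the space obtained from $\xi^{\mathbb{P}}$ by identifying, for each $x\in X$, the subset $\mathbb{P}\xi_x\subset\mathbb{P}\xi\subset\xi^{\mathbb{P}}$ to a point. The map $q$ is the identification map obtained from the definition of $\xi^{\mathrm{P}}$. It identifies, for each $x\in X$, the points $(0,\pm1)$ in the fibre over $x$.
   Context: Let $d$ denote the complex rank of $\xi$, and let $\|\cdot\|$ denote the norm on the fibres of $\xi$ coming from a Hermitian metric. Three fibrewise compactifications of $\xi$ are considered, each with a projection to $X$ and a natural inclusion of $\xi$ as a dense open subset, commuting with the projections to $X$: (1) the projective compactification $\xi^{\mathbb{P}}=\mathbb{P}(\xi\oplus\mathbb{C})$, the projectivisation of $\xi\oplus\mathbb{C}\to X$, a bundle of projective spaces $\mathbb{C}\mathrm{P}^{d}$ over $X$; the inclusion $\xi\hookrightarrow\xi^{\mathbb{P}}$ sends $v\in\xi_x$ to the line spanned by $(v,1)$ in $\xi_x\oplus\mathbb{C}$; there is also a natural inclusion $\mathbb{P}\xi\hookrightarrow\mathbb{P}(\xi\oplus\mathbb{C})=\xi^{\mathbb{P}}$, sending a line $l\subset\xi_x$ to $l\oplus 0$; (2) the spherical compactification $\xi^{\mathrm{S}}=\mathbb{S}(\xi\oplus\mathbb{R})$,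 the unit sphere bundle of the real vector bundle $\xi\oplus\mathbb{R}\to X$, a bundle of spheres of dimension $2d$; the inclusion $\xi\hookrightarrow\xi^{\mathrm{S}}$ sends $v\in\xi_x$ to the unit vector $\left(\frac{2v}{\|v\|^2+1},\frac{\|v\|^2-1}{\|v\|^2+1}\right)$ in $\xi_x\oplus\mathbb{R}$; (3) the pinched compactification $\xi^{\mathrm{P}}$, the space obtained from $\xi^{\mathrm{S}}$ by identifying, for each $x\in X$, the points $(0,1)$ and $(0,-1)$ in the fibre over $x$; the inclusion $\xi\hookrightarrow\xi^{\mathrm{P}}$ is the composite of the inclusion $\xi\hookrightarrow\xi^{\mathrm{S}}$ with the identification map $\xi^{\mathrm{S}}\to\xi^{\mathrm{P}}$. *)

theory Defs
  imports "HOL-Analysis.Analysis"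
begin

section \<open>Identification spaces\<close>

text \<open>The set \<open>f ` topspace T\<close> with the finest topology making \<open>f\<close> continuous.\<close>

definition identification_topology :: "'a topology \<Rightarrow> ('a \<Rightarrow> 'b) \<Rightarrow> 'b topology" where
  "identification_topology T f =
     topology (\<lambda>U. U \<subseteq> f ` topspace T \<and> openin T {x \<in> topspace T. f x \<in> U})"

lemma openin_identification_topology:
  "openin (identification_topology T f) U \<longleftrightarrow>
     U \<subseteq> f ` topspace T \<and> openin T {x \<in> topspace T. f x \<in> U}"
proof -
  have "istopology (\<lambda>U. U \<subseteq> f ` topspace T \<and> openin T {x \<in> topspace T. f x \<in> U})"
    unfolding istopology_def
  proof (intro conjI allI impI)
    fix S U
    assume "S \<subseteq> f ` topspace T \<and> openin T {x \<in> topspace T. f x \<in> S}"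
      and "U \<subseteq> f ` topspace T \<and> openin T {x \<in> topspace T. f x \<in> U}"
    then have "openin T ({x \<in> topspace T. f x \<in> S} \<inter> {x \<in> topspace T. f x \<in> U})"
      by blast
    moreover have "{x \<in> topspace T. f x \<in> S} \<inter> {x \<in> topspace T. f x \<in> U}
        = {x \<in> topspace T. f x \<in> S \<inter> U}" by blast
    ultimately show "openin T {x \<in> topspace T. f x \<in> S \<inter> U}" by simp
  next
    fix K
    assume K: "\<forall>S\<in>K. S \<subseteq> f ` topspace T \<and> openin T {x \<in> topspace T. f x \<in> S}"
    then have "openin T (\<Union>S\<in>K. {x \<in> topspace T. f x \<in> S})" by blast
    moreover have "(\<Union>S\<in>K. {x \<in> topspace T. f x \<in> S}) = {x \<in> topspace T. f x \<in> \<Union>K}" by blast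
    ultimately show "openin T {x \<in> topspace T. f x \<in> \<Union>K}" by simp
  qed blast+
  then show ?thesis
    by (simp add: identification_topology_def)
qed

lemma topspace_identification_topology [simp]:
  "topspace (identification_topology T f) = f ` topspace T"
proof -
  have "{x \<in> topspace T. f x \<in> f ` topspace T} = topspace T" by blast
  then have "openin (identification_topology T f) (f ` topspace T)"
    by (simp add: openin_identification_topology)
  then have "f ` topspace T \<subseteq> topspace (identification_topology T f)"
    by (rule openin_subset)
  moreover have "topspace (identification_topology T f) \<subseteq> f ` topspace T"
    using openin_topspace [of "identification_topology T f"]
    by (simp only: openin_identification_topology)
  ultimately show ?thesis by blast
qed

lemma quotient_map_identification_topology:
  "quotient_map T (identification_topology T f) f"
  by (auto simp: quotient_map_def openin_identification_topology)

text \<open>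
  \<open>collapse_space T I A\<close> is the space obtained from \<open>T\<close> by identifying, for each \<open>i \<in> I\<close>, the
  subset \<open>A i\<close> to a point (a separate point for each \<open>i\<close>).  Its points are the equivalence
  classes.  The relation is an equivalence relation whenever the sets \<open>A i\<close> are pairwise
  disjoint; below they always lie in different fibres over the base.
\<close>

definition collapse_rel :: "'a topology \<Rightarrow> 'i set \<Rightarrow> ('i \<Rightarrow> 'a set) \<Rightarrow> ('a \<times> 'a) set" where
  "collapse_rel T I A =
     {(y, z). y \<in> topspace T \<and> z \<in> topspace T \<and> (y = z \<or> (\<exists>i\<in>I. y \<in> A i \<and> z \<in> A i))}"

definition collapse_class :: "'a topology \<Rightarrow> 'i set \<Rightarrow> ('i \<Rightarrow> 'a set) \<Rightarrow> 'a \<Rightarrow> 'a set" where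
  "collapse_class T I A y = collapse_rel T I A `` {y}"

definition collapse_space :: "'a topology \<Rightarrow> 'i set \<Rightarrow> ('i \<Rightarrow> 'a set) \<Rightarrow> 'a set topology" where
  "collapse_space T I A = identification_topology T (collapse_class T I A)"

text \<open>The value of \<open>f\<close> on a class on which it is constant.\<close>

definition value_on_class :: "('a \<Rightarrow> 'b) \<Rightarrow> 'a set \<Rightarrow> 'b" where
  "value_on_class f C = (THE b. f ` C = {b})"


section \<open>Complex vector bundles\<close>

record ('e, 'x) cbundle =
  total :: "'e topology"
  base :: "'x topology"
  proj :: "'e \<Rightarrow> 'x"
  vadd :: "'e \<Rightarrow> 'e \<Rightarrow> 'e"
  smul :: "complex \<Rightarrow> 'e \<Rightarrow> 'e"
  vzero :: "'x \<Rightarrow> 'e"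

definition fibre :: "('e, 'x) cbundle \<Rightarrow> 'x \<Rightarrow> 'e set" where
  "fibre \<xi> x = {v \<in> topspace (total \<xi>). proj \<xi> v = x}"

definition complex_vector_space_on ::
    "'e set \<Rightarrow> ('e \<Rightarrow> 'e \<Rightarrow> 'e) \<Rightarrow> (complex \<Rightarrow> 'e \<Rightarrow> 'e) \<Rightarrow> 'e \<Rightarrow> bool" where
  "complex_vector_space_on V add scl zero \<longleftrightarrow>
     zero \<in> V \<and>
     (\<forall>v\<in>V. \<forall>w\<in>V. add v w \<in> V) \<and>
     (\<forall>c. \<forall>v\<in>V. scl c v \<in> V) \<and>
     (\<forall>u\<in>V. \<forall>v\<in>V. \<forall>w\<in>V. add (add u v) w = add u (add v w)) \<and>
     (\<forall>v\<in>V. \<forall>w\<in>V. add v w = add w v) \<and>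
     (\<forall>v\<in>V. add zero v = v) \<and>
     (\<forall>v\<in>V. \<exists>w\<in>V. add v w = zero) \<and>
     (\<forall>c. \<forall>v\<in>V. \<forall>w\<in>V. scl c (add v w) = add (scl c v) (scl c w)) \<and>
     (\<forall>b c. \<forall>v\<in>V. scl (b + c) v = add (scl b v) (scl c v)) \<and>
     (\<forall>b c. \<forall>v\<in>V. scl (b * c) v = scl b (scl c v)) \<and>
     (\<forall>v\<in>V. scl 1 v = v)"

text \<open>
  \<open>\<phi>\<close> is the vector component of a local trivialisation
  \<open>v \<mapsto> (proj \<xi> v, \<phi> v)\<close> over \<open>U\<close>.
\<close>

definition local_trivialisation ::
    "('e, 'x) cbundle \<Rightarrow> 'x set \<Rightarrow> ('e \<Rightarrow> complex ^ 'n) \<Rightarrow> bool" where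
  "local_trivialisation \<xi> U \<phi> \<longleftrightarrow>
     homeomorphic_map
       (subtopology (total \<xi>) {v. proj \<xi> v \<in> U})
       (prod_topology (subtopology (base \<xi>) U) euclidean)
       (\<lambda>v. (proj \<xi> v, \<phi> v)) \<and>
     (\<forall>x\<in>U. \<forall>v\<in>fibre \<xi> x. \<forall>w\<in>fibre \<xi> x. \<phi> (vadd \<xi> v w) = \<phi> v + \<phi> w) \<and>
     (\<forall>x\<in>U. \<forall>c. \<forall>v\<in>fibre \<xi> x. \<phi> (smul \<xi> c v) = c *s \<phi> v)"

text \<open>The type argument fixes the rank \<open>d = CARD('n) \<ge> 1\<close>.  In rank 0 the unit sphere
  bundle of \<open>\<xi> \<oplus> \<real>\<close> is two copies of the base, and \<open>\<xi>\<close> is not dense in it.\<close>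

definition complex_vector_bundle :: "'n::finite itself \<Rightarrow> ('e, 'x) cbundle \<Rightarrow> bool" where
  "complex_vector_bundle (_ :: 'n itself) \<xi> \<longleftrightarrow>
     continuous_map (total \<xi>) (base \<xi>) (proj \<xi>) \<and>
     (\<forall>x\<in>topspace (base \<xi>).
        complex_vector_space_on (fibre \<xi> x) (vadd \<xi>) (smul \<xi>) (vzero \<xi> x)) \<and>
     (\<forall>x\<in>topspace (base \<xi>). \<exists>U. openin (base \<xi>) U \<and> x \<in> U \<and>
        (\<exists>\<phi> :: 'e \<Rightarrow> complex ^ 'n. local_trivialisation \<xi> U \<phi>))"

text \<open>Hermitian forms are taken to be complex linear in the first argument.\<close>

definition hermitian_metric :: "('e, 'x) cbundle \<Rightarrow> ('e \<Rightarrow> 'e \<Rightarrow> complex) \<Rightarrow> bool" where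
  "hermitian_metric \<xi> h \<longleftrightarrow>
     continuous_map
       (subtopology (prod_topology (total \<xi>) (total \<xi>)) {(v, w). proj \<xi> v = proj \<xi> w})
       euclidean (\<lambda>(v, w). h v w) \<and>
     (\<forall>x\<in>topspace (base \<xi>).
        (\<forall>u\<in>fibre \<xi> x. \<forall>v\<in>fibre \<xi> x. \<forall>w\<in>fibre \<xi> x. h (vadd \<xi> u v) w = h u w + h v w) \<and>
        (\<forall>c. \<forall>v\<in>fibre \<xi> x. \<forall>w\<in>fibre \<xi> x. h (smul \<xi> c v) w = c * h v w) \<and>
        (\<forall>v\<in>fibre \<xi> x. \<forall>w\<in>fibre \<xi> x. h w v = cnj (h v w)) \<and>
        (\<forall>v\<in>fibre \<xi> x. v \<noteq> vzero \<xi> x \<longrightarrow> Re (h v v) > 0))"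

definition fnorm :: "('e \<Rightarrow> 'e \<Rightarrow> complex) \<Rightarrow> 'e \<Rightarrow> real" where
  "fnorm h v = sqrt (Re (h v v))"


section \<open>Projectivisation and the projective compactification\<close>

definition nonzero_vectors :: "('e, 'x) cbundle \<Rightarrow> 'e set" where
  "nonzero_vectors \<xi> = {v \<in> topspace (total \<xi>). v \<noteq> vzero \<xi> (proj \<xi> v)}"

definition line :: "('e, 'x) cbundle \<Rightarrow> 'e \<Rightarrow> 'e set" where
  "line \<xi> v = range (\<lambda>c. smul \<xi> c v)"

text \<open>
  The points of \<open>\<P>\<xi>\<close> are the complex lines in the fibres of \<open>\<xi>\<close>, topologised as a quotient of
  the complement of the zero section.
\<close>

definition projectivisation :: "('e, 'x) cbundle \<Rightarrow> 'e set topology" where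
  "projectivisation \<xi> =
     identification_topology (subtopology (total \<xi>) (nonzero_vectors \<xi>)) (line \<xi>)"

definition projectivisation_proj :: "('e, 'x) cbundle \<Rightarrow> 'e set \<Rightarrow> 'x" where
  "projectivisation_proj \<xi> = value_on_class (proj \<xi>)"

definition projectivisation_fibre :: "('e, 'x) cbundle \<Rightarrow> 'x \<Rightarrow> 'e set set" where
  "projectivisation_fibre \<xi> x =
     {l \<in> topspace (projectivisation \<xi>). projectivisation_proj \<xi> l = x}"

text \<open>
  The total space of the Whitney sum \<open>\<xi> \<oplus> \<complex>\<close> is the fibre product of \<open>\<xi>\<close> and \<open>X \<times> \<complex>\<close> over the
  base \<open>X\<close>, that is, the product of the total space of \<open>\<xi>\<close> with \<open>\<complex>\<close>.
\<close>

definition plus_C :: "('e, 'x) cbundle \<Rightarrow> ('e \<times> complex, 'x) cbundle" where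
  "plus_C \<xi> =
     \<lparr> total = prod_topology (total \<xi>) euclidean,
       base = base \<xi>,
       proj = (\<lambda>(v, a). proj \<xi> v),
       vadd = (\<lambda>(v, a) (w, b). (vadd \<xi> v w, a + b)),
       smul = (\<lambda>c (v, a). (smul \<xi> c v, c * a)),
       vzero = (\<lambda>x. (vzero \<xi> x, 0)) \<rparr>"

definition proj_compactification :: "('e, 'x) cbundle \<Rightarrow> ('e \<times> complex) set topology" where
  "proj_compactification \<xi> = projectivisation (plus_C \<xi>)"

definition proj_compactification_proj :: "('e, 'x) cbundle \<Rightarrow> ('e \<times> complex) set \<Rightarrow> 'x" where
  "proj_compactification_proj \<xi> = projectivisation_proj (plus_C \<xi>)"

definition proj_compactification_incl :: "('e, 'x) cbundle \<Rightarrow> 'e \<Rightarrow> ('e \<times> complex) set" where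
  "proj_compactification_incl \<xi> v = line (plus_C \<xi>) (v, 1)"

text \<open>The inclusion \<open>\<P>\<xi> \<rightarrow> \<P>(\<xi> \<oplus> \<complex>)\<close>, \<open>l \<mapsto> l \<oplus> 0\<close>.\<close>

definition line_plus_0 :: "'e set \<Rightarrow> ('e \<times> complex) set" where
  "line_plus_0 l = l \<times> {0}"

definition fibre_at_infinity :: "('e, 'x) cbundle \<Rightarrow> 'x \<Rightarrow> ('e \<times> complex) set set" where
  "fibre_at_infinity \<xi> x = line_plus_0 ` projectivisation_fibre \<xi> x"


section \<open>The spherical and pinched compactifications\<close>

text \<open>The norm on \<open>\<xi> \<oplus> \<real>\<close> of the orthogonal direct sum of \<open>h\<close> and the standard metric.\<close>

definition fnorm_plus_R :: "('e \<Rightarrow> 'e \<Rightarrow> complex) \<Rightarrow> 'e \<times> real \<Rightarrow> real" where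
  "fnorm_plus_R h = (\<lambda>(v, t). sqrt ((fnorm h v)\<^sup>2 + t\<^sup>2))"

definition sph_compactification ::
    "('e, 'x) cbundle \<Rightarrow> ('e \<Rightarrow> 'e \<Rightarrow> complex) \<Rightarrow> ('e \<times> real) topology" where
  "sph_compactification \<xi> h =
     subtopology (prod_topology (total \<xi>) euclideanreal) {z. fnorm_plus_R h z = 1}"

definition sph_compactification_proj :: "('e, 'x) cbundle \<Rightarrow> 'e \<times> real \<Rightarrow> 'x" where
  "sph_compactification_proj \<xi> = (\<lambda>(v, t). proj \<xi> v)"

definition sph_compactification_incl ::
    "('e, 'x) cbundle \<Rightarrow> ('e \<Rightarrow> 'e \<Rightarrow> complex) \<Rightarrow> 'e \<Rightarrow> 'e \<times> real" where
  "sph_compactification_incl \<xi> h v =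
     (smul \<xi> (complex_of_real (2 / ((fnorm h v)\<^sup>2 + 1))) v,
      ((fnorm h v)\<^sup>2 - 1) / ((fnorm h v)\<^sup>2 + 1))"

definition poles :: "('e, 'x) cbundle \<Rightarrow> 'x \<Rightarrow> ('e \<times> real) set" where
  "poles \<xi> x = {(vzero \<xi> x, 1), (vzero \<xi> x, -1)}"

definition pinch_compactification ::
    "('e, 'x) cbundle \<Rightarrow> ('e \<Rightarrow> 'e \<Rightarrow> complex) \<Rightarrow> ('e \<times> real) set topology" where
  "pinch_compactification \<xi> h =
     collapse_space (sph_compactification \<xi> h) (topspace (base \<xi>)) (poles \<xi>)"

definition pinch_map ::
    "('e, 'x) cbundle \<Rightarrow> ('e \<Rightarrow> 'e \<Rightarrow> complex) \<Rightarrow> 'e \<times> real \<Rightarrow> ('e \<times> real) set" where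
  "pinch_map \<xi> h =
     collapse_class (sph_compactification \<xi> h) (topspace (base \<xi>)) (poles \<xi>)"

definition pinch_compactification_proj :: "('e, 'x) cbundle \<Rightarrow> ('e \<times> real) set \<Rightarrow> 'x" where
  "pinch_compactification_proj \<xi> = value_on_class (sph_compactification_proj \<xi>)"

definition pinch_compactification_incl ::
    "('e, 'x) cbundle \<Rightarrow> ('e \<Rightarrow> 'e \<Rightarrow> complex) \<Rightarrow> 'e \<Rightarrow> ('e \<times> real) set" where
  "pinch_compactification_incl \<xi> h v = pinch_map \<xi> h (sph_compactification_incl \<xi> h v)"

end

theory Submission
  imports Defs
begin

text \<open>
  A nonzero vector \<open>(v, a)\<close> of \<open>\<xi> \<oplus> \<complex>\<close> is sent to the point
  \<open>(2 cnj a v, \<parallel>v\<parallel>\<^sup>2 - \<bar>a\<bar>\<^sup>2) / (\<parallel>v\<parallel>\<^sup>2 + \<bar>a\<bar>\<^sup>2)\<close> of the sphere bundle.  This is invariant under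
  scaling, is inverse stereographic projection for \<open>a = 1\<close>, and takes the value \<open>(0, 1)\<close> exactly at the
  lines \<open>a = 0\<close>.  Off that pole \<open>(w, t) \<mapsto> (w, 1 - t)\<close> is a continuous section, and near the pole
  compactness of the fibre at infinity takes over, so the map is a quotient map; its fibres are the
  lines together with the subspaces \<open>\<P>\<xi>\<^sub>x\<close>.
\<close>

section \<open>Collapsed spaces\<close>

text \<open>The formula comes from evaluating inverse stereographic projection at
  \<open>v / a\<close> and clearing the denominator \<open>|a|^2\<close>; this turns
  \<open>1 / a\<close> into \<open>cnj a\<close> and leaves an expression that also makes sense at
  \<open>a = 0\<close>. The base carries no separation or compactness assumption, so the continuous
  bijection out of the collapsed space cannot be inverted by a compact-to-Hausdorff argument. The
  section cannot be extended either: at the pole \<open>(w, 1 - t)\<close> degenerates to the zero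
  vector, which spans no line. What has to be shown is that a subset of the sphere bundle with open
  preimage is open. The hard points are the poles \<open>(0, 1)\<close>, where the estimate must be
  uniform over all directions in a fibre and over nearby fibres, whose metrics vary. Once this is
  known, two quotient maps with the same fibres have homeomorphic targets, and no inverse needs to
  be written down.\<close>

lemma collapse_class_eq:
  assumes disj: "\<And>i j y. i \<in> I \<Longrightarrow> j \<in> I \<Longrightarrow> y \<in> A i \<Longrightarrow> y \<in> A j \<Longrightarrow> i = j"
    and "i \<in> I" "y \<in> A i" "y \<in> topspace T"
  shows "collapse_class T I A y = topspace T \<inter> A i"
proof -
  have "(\<exists>j\<in>I. y \<in> A j \<and> w \<in> A j) \<longleftrightarrow> w \<in> A i" for w
    using disj[OF assms(2) _ assms(3)] assms(2,3) by blast
  then show ?thesis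
    using assms(3,4) by (auto simp: collapse_class_def collapse_rel_def)
qed

text \<open>A point is related to itself, so equal classes force related points. Conversely,
  disjointness plays the role of transitivity: the class of a point of \<open>A i\<close> is then
  all of \<open>A i\<close> inside the space.\<close>

lemma collapse_class_eq_iff:
  assumes disj: "\<And>i j y. i \<in> I \<Longrightarrow> j \<in> I \<Longrightarrow> y \<in> A i \<Longrightarrow> y \<in> A j \<Longrightarrow> i = j"
    and yz: "y \<in> topspace T" "z \<in> topspace T"
  shows "collapse_class T I A y = collapse_class T I A z \<longleftrightarrow>
    y = z \<or> (\<exists>i\<in>I. y \<in> A i \<and> z \<in> A i)"
proof
  assume "collapse_class T I A y = collapse_class T I A z"
  moreover have "z \<in> collapse_class T I A z"
    using yz by (simp add: collapse_class_def collapse_rel_def)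
  ultimately have "(y, z) \<in> collapse_rel T I A"
    by (metis Image_singleton_iff collapse_class_def)
  then show "y = z \<or> (\<exists>i\<in>I. y \<in> A i \<and> z \<in> A i)"
    by (simp add: collapse_rel_def)
next
  assume "y = z \<or> (\<exists>i\<in>I. y \<in> A i \<and> z \<in> A i)"
  then show "collapse_class T I A y = collapse_class T I A z"
    using collapse_class_eq[where T = T and I = I and A = A] disj yz by metis
qed

lemma quotient_map_collapse_class: "quotient_map T (collapse_space T I A) (collapse_class T I A)"
  by (simp add: collapse_space_def quotient_map_identification_topology)

text \<open>Each map is constant on the fibres of the other and so factors through it; the two
  factorisations are mutually inverse because both maps are onto.\<close>

lemma quotient_maps_same_fibres_homeomorphic:
  assumes f: "quotient_map X Y f" and g: "quotient_map X Z g"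
    and eq: "\<And>x x'. x \<in> topspace X \<Longrightarrow> x' \<in> topspace X \<Longrightarrow> f x = f x' \<longleftrightarrow> g x = g x'"
  obtains k where "homeomorphic_map Y Z k" "\<And>x. x \<in> topspace X \<Longrightarrow> k (f x) = g x"
proof -
  obtain k where k: "continuous_map Y Z k" "\<And>x. x \<in> topspace X \<Longrightarrow> k (f x) = g x"
    using quotient_map_lift_exists[OF f quotient_imp_continuous_map[OF g]] eq by metis
  obtain l where l: "continuous_map Z Y l" "\<And>x. x \<in> topspace X \<Longrightarrow> l (g x) = f x"
    using quotient_map_lift_exists[OF g quotient_imp_continuous_map[OF f]] eq by metis
  have "topspace Y = f ` topspace X" "topspace Z = g ` topspace X"
    using f g by (auto simp: quotient_map_def)
  then have "homeomorphic_maps Y Z k l"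
    using k l by (auto simp: homeomorphic_maps_def)
  then show thesis
    using k(2) that homeomorphic_map_maps by blast
qed

lemma value_on_class_eq: "f ` C = {b} \<Longrightarrow> value_on_class f C = b"
  by (simp add: value_on_class_def)


section \<open>Families of vector spaces and their lines\<close>

lemma complex_vector_space_onD [rule_format]:
  assumes "complex_vector_space_on V add scl zero"
  shows complex_vector_space_on_zero: "zero \<in> V"
    and complex_vector_space_on_add [rule_format]: "\<forall>v\<in>V. \<forall>w\<in>V. add v w \<in> V"
    and complex_vector_space_on_scale [rule_format]: "\<forall>c. \<forall>v\<in>V. scl c v \<in> V"
    and complex_vector_space_on_assoc [rule_format]:
      "\<forall>u\<in>V. \<forall>v\<in>V. \<forall>w\<in>V. add (add u v) w = add u (add v w)"
    and complex_vector_space_on_commute [rule_format]: "\<forall>v\<in>V. \<forall>w\<in>V. add v w = add w v"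
    and complex_vector_space_on_add_zero [rule_format]: "\<forall>v\<in>V. add zero v = v"
    and complex_vector_space_on_inverse [rule_format]: "\<forall>v\<in>V. \<exists>w\<in>V. add v w = zero"
    and complex_vector_space_on_scale_add_right [rule_format]:
      "\<forall>c. \<forall>v\<in>V. \<forall>w\<in>V. scl c (add v w) = add (scl c v) (scl c w)"
    and complex_vector_space_on_scale_add [rule_format]:
      "\<forall>b c. \<forall>v\<in>V. scl (b + c) v = add (scl b v) (scl c v)"
    and complex_vector_space_on_scale_mult [rule_format]:
      "\<forall>b c. \<forall>v\<in>V. scl (b * c) v = scl b (scl c v)"
    and complex_vector_space_on_scale_1 [rule_format]: "\<forall>v\<in>V. scl 1 v = v"
  using assms unfolding complex_vector_space_on_def by - (elim conjE, assumption)+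

lemma complex_vector_space_on_scale_0:
  assumes V: "complex_vector_space_on V add scl zero" and v: "v \<in> V"
  shows "scl 0 v = zero"
proof -
  note D = complex_vector_space_onD[OF V]
  let ?s = "scl 0 v"
  have s: "?s \<in> V"
    using D(3) v by blast
  have ss: "add ?s ?s = ?s"
    using D(9)[OF v, of 0 0] by simp
  obtain w where w: "w \<in> V" "add ?s w = zero"
    using D(7)[OF s] by blast
  have "zero = add (add ?s ?s) w"
    using w ss by simp
  also have "\<dots> = add ?s zero"
    using D(4)[OF s s w(1)] w by simp
  also have "\<dots> = ?s"
    using D(5)[OF s D(1)] D(6)[OF s] by simp
  finally show ?thesis by simp
qed

text \<open>Only fibrewise algebra is assumed, no continuity and no local triviality, so that the
  calculus of lines applies to \<open>plus_C \<xi>\<close> as well as to \<open>\<xi>\<close>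
  without constructing charts for the sum.\<close>

locale vector_space_family =
  fixes \<xi> :: "('e, 'x) cbundle"
  assumes proj_in_base: "v \<in> topspace (total \<xi>) \<Longrightarrow> proj \<xi> v \<in> topspace (base \<xi>)"
    and fibre_space:
      "x \<in> topspace (base \<xi>) \<Longrightarrow>
        complex_vector_space_on (fibre \<xi> x) (vadd \<xi>) (smul \<xi>) (vzero \<xi> x)"
begin

lemma in_fibre: "v \<in> topspace (total \<xi>) \<Longrightarrow> v \<in> fibre \<xi> (proj \<xi> v)"
  by (simp add: fibre_def)

lemma vzero_in_fibre: "x \<in> topspace (base \<xi>) \<Longrightarrow> vzero \<xi> x \<in> fibre \<xi> x"
  using complex_vector_space_on_zero[OF fibre_space] .

lemma vzero_in_total [simp]: "x \<in> topspace (base \<xi>) \<Longrightarrow> vzero \<xi> x \<in> topspace (total \<xi>)"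
  using vzero_in_fibre by (auto simp: fibre_def)

lemma proj_vzero [simp]: "x \<in> topspace (base \<xi>) \<Longrightarrow> proj \<xi> (vzero \<xi> x) = x"
  using vzero_in_fibre by (auto simp: fibre_def)

lemma smul_in_fibre: "v \<in> topspace (total \<xi>) \<Longrightarrow> smul \<xi> c v \<in> fibre \<xi> (proj \<xi> v)"
  using complex_vector_space_on_scale[OF fibre_space[OF proj_in_base] in_fibre] .

lemma smul_in_total [simp]: "v \<in> topspace (total \<xi>) \<Longrightarrow> smul \<xi> c v \<in> topspace (total \<xi>)"
  using smul_in_fibre by (auto simp: fibre_def)

lemma proj_smul [simp]: "v \<in> topspace (total \<xi>) \<Longrightarrow> proj \<xi> (smul \<xi> c v) = proj \<xi> v"
  using smul_in_fibre by (auto simp: fibre_def)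

lemma smul_smul [simp]: "v \<in> topspace (total \<xi>) \<Longrightarrow> smul \<xi> b (smul \<xi> c v) = smul \<xi> (b * c) v"
  using complex_vector_space_on_scale_mult[OF fibre_space[OF proj_in_base] in_fibre, symmetric] .

lemma smul_1 [simp]: "v \<in> topspace (total \<xi>) \<Longrightarrow> smul \<xi> 1 v = v"
  using complex_vector_space_on_scale_1[OF fibre_space[OF proj_in_base] in_fibre] .

lemma smul_0 [simp]: "v \<in> topspace (total \<xi>) \<Longrightarrow> smul \<xi> 0 v = vzero \<xi> (proj \<xi> v)"
  using complex_vector_space_on_scale_0[OF fibre_space[OF proj_in_base] in_fibre] .

lemma smul_vzero [simp]:
  assumes "x \<in> topspace (base \<xi>)"
  shows "smul \<xi> c (vzero \<xi> x) = vzero \<xi> x"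
  using assms smul_smul[of "vzero \<xi> x" c 0] by simp

lemma line_smul:
  assumes v: "v \<in> topspace (total \<xi>)" and c: "c \<noteq> 0"
  shows "line \<xi> (smul \<xi> c v) = line \<xi> v"
proof -
  have "surj (\<lambda>b. b * c)"
    using c by (intro surjI[of _ "\<lambda>b. b / c"]) simp
  then have "range (\<lambda>b. smul \<xi> (b * c) v) = range (\<lambda>b. smul \<xi> b v)"
    using image_image[of "\<lambda>b. smul \<xi> b v" "\<lambda>b. b * c" UNIV] by simp
  then show ?thesis
    using v by (simp add: line_def)
qed

text \<open>The vector \<open>w\<close> lies on its own line, hence on that of \<open>v\<close>; the
  factor cannot be 0, since that would make \<open>w\<close> the zero vector.\<close>

lemma line_eq_obtains:
  assumes v: "v \<in> topspace (total \<xi>)" and w: "w \<in> nonzero_vectors \<xi>" and "line \<xi> v = line \<xi> w"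
  obtains c where "c \<noteq> 0" "w = smul \<xi> c v"
proof -
  have wt: "w \<in> topspace (total \<xi>)" and w0: "w \<noteq> vzero \<xi> (proj \<xi> w)"
    using w by (auto simp: nonzero_vectors_def)
  have "smul \<xi> 1 w \<in> line \<xi> w"
    unfolding line_def by blast
  then obtain c where "w = smul \<xi> c v"
    using assms(3) wt by (auto simp: line_def)
  moreover have "c \<noteq> 0"
    using calculation w0 v by auto
  ultimately show thesis
    using that by blast
qed

lemma topspace_projectivisation: "topspace (projectivisation \<xi>) = line \<xi> ` nonzero_vectors \<xi>"
proof -
  have "topspace (total \<xi>) \<inter> nonzero_vectors \<xi> = nonzero_vectors \<xi>"
    by (auto simp: nonzero_vectors_def)
  then show ?thesis
    by (simp add: projectivisation_def)
qed

lemma projectivisation_proj_line [simp]: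
  assumes "v \<in> topspace (total \<xi>)"
  shows "projectivisation_proj \<xi> (line \<xi> v) = proj \<xi> v"
  unfolding projectivisation_proj_def
  by (rule value_on_class_eq) (use assms in \<open>simp add: line_def image_image image_constant_conv\<close>)

lemma projectivisation_fibre_eq:
  "projectivisation_fibre \<xi> x = line \<xi> ` {v \<in> nonzero_vectors \<xi>. proj \<xi> v = x}"
proof -
  have "projectivisation_proj \<xi> (line \<xi> v) = proj \<xi> v" if "v \<in> nonzero_vectors \<xi>" for v
    using that by (simp add: nonzero_vectors_def)
  then show ?thesis
    by (auto simp: projectivisation_fibre_def topspace_projectivisation)
qed

lemma plus_C_family: "vector_space_family (plus_C \<xi>)"
proof
  show "proj (plus_C \<xi>) v \<in> topspace (base (plus_C \<xi>))" if "v \<in> topspace (total (plus_C \<xi>))" for v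
    using that proj_in_base by (auto simp: plus_C_def)
next
  fix x assume "x \<in> topspace (base (plus_C \<xi>))"
  then have V: "complex_vector_space_on (fibre \<xi> x) (vadd \<xi>) (smul \<xi>) (vzero \<xi> x)"
    using fibre_space by (simp add: plus_C_def)
  note D = complex_vector_space_onD[OF V]
  have "\<exists>b. a + b = 0" for a :: complex
    by (metis add.right_inverse)
  moreover have fib: "fibre (plus_C \<xi>) x = fibre \<xi> x \<times> UNIV"
    by (auto simp: fibre_def plus_C_def)
  ultimately show "complex_vector_space_on (fibre (plus_C \<xi>) x) (vadd (plus_C \<xi>)) (smul (plus_C \<xi>))
          (vzero (plus_C \<xi>) x)"
    unfolding fib complex_vector_space_on_def
    apply (intro conjI allI ballI)
    subgoal using D(1) by (simp add: plus_C_def)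
    subgoal using D(2) by (auto simp: plus_C_def)
    subgoal using D(3) by (auto simp: plus_C_def)
    subgoal using D(4) by (auto simp: plus_C_def)
    subgoal for v w using D(5)[of "fst v" "fst w"] by (auto simp: plus_C_def)
    subgoal using D(6) by (auto simp: plus_C_def)
    subgoal for v using D(7)[of "fst v"] by (auto simp: plus_C_def)
    subgoal using D(8) by (auto simp: plus_C_def ring_distribs)
    subgoal using D(9) by (auto simp: plus_C_def ring_distribs)
    subgoal using D(10) by (auto simp: plus_C_def)
    subgoal using D(11) by (auto simp: plus_C_def)
    done
qed

end

section \<open>Hermitian vector bundles\<close>

text \<open>The pasting lemma for an open cover with the same function on every piece, so that
  agreement on overlaps is automatic.\<close>

lemma continuous_map_locally:
  assumes "\<And>x. x \<in> topspace X \<Longrightarrow> \<exists>U. openin X U \<and> x \<in> U \<and> continuous_map (subtopology X U) Y f"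
  shows "continuous_map X Y f"
  by (rule pasting_lemma[where I = "{U. openin X U \<and> continuous_map (subtopology X U) Y f}"
        and T = id and f = "\<lambda>_. f"]) (use assms in auto)

text \<open>For maps into a Euclidean space, continuity is convergence along the filters
  \<open>atin\<close>; the arithmetic of limits then applies although the source is an abstract
  topology. The same device serves the later continuity proofs.\<close>

lemma continuous_map_vector_scalar_mult:
  fixes f :: "'a \<Rightarrow> complex" and g :: "'a \<Rightarrow> complex ^ 'n"
  assumes "continuous_map X euclidean f" "continuous_map X euclidean g"
  shows "continuous_map X euclidean (\<lambda>x. f x *s g x)"
  using assms unfolding continuous_map_atin vector_scalar_mult_def limitin_canonical_iff
  by (intro ballI tendsto_vec_lambda tendsto_mult tendsto_vec_nth) auto

lemma norm_of_real_scalar_mult: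
  fixes u :: "complex ^ 'n"
  shows "norm (complex_of_real r *s u) = \<bar>r\<bar> * norm u"
proof -
  have "complex_of_real r *s u = r *\<^sub>R u"
    by (simp add: vec_eq_iff scaleR_conv_of_real[where 'a = complex])
  then show ?thesis by simp
qed

lemma total_plus_C [simp]: "total (plus_C \<xi>) = prod_topology (total \<xi>) euclidean"
  and base_plus_C [simp]: "base (plus_C \<xi>) = base \<xi>"
  and proj_plus_C [simp]: "proj (plus_C \<xi>) (v, a) = proj \<xi> v"
  and smul_plus_C [simp]: "smul (plus_C \<xi>) c (v, a) = (smul \<xi> c v, c * a)"
  and vzero_plus_C [simp]: "vzero (plus_C \<xi>) x = (vzero \<xi> x, 0)"
  by (simp_all add: plus_C_def)

lemma mem_nonzero_vectors_plus_C [simp]: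
  "(v, a) \<in> nonzero_vectors (plus_C \<xi>) \<longleftrightarrow>
    v \<in> topspace (total \<xi>) \<and> (v \<noteq> vzero \<xi> (proj \<xi> v) \<or> a \<noteq> 0)"
  by (auto simp: nonzero_vectors_def)

locale hermitian_bundle =
  fixes \<xi> :: "('e, 'x) cbundle" and h :: "'e \<Rightarrow> 'e \<Rightarrow> complex" and rank_type :: "'n::finite itself"
  assumes vector_bundle: "complex_vector_bundle rank_type \<xi>"
    and metric: "hermitian_metric \<xi> h"

sublocale hermitian_bundle \<subseteq> vector_space_family \<xi>
proof
  show "proj \<xi> v \<in> topspace (base \<xi>)" if "v \<in> topspace (total \<xi>)" for v
    using vector_bundle that unfolding complex_vector_bundle_def continuous_map_def by blast
  show "complex_vector_space_on (fibre \<xi> x) (vadd \<xi>) (smul \<xi>) (vzero \<xi> x)"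
    if "x \<in> topspace (base \<xi>)" for x
    using vector_bundle that unfolding complex_vector_bundle_def by blast
qed

context hermitian_bundle
begin

section \<open>Charts and the continuity of scalar multiplication\<close>

lemma continuous_map_proj: "continuous_map (total \<xi>) (base \<xi>) (proj \<xi>)"
  using vector_bundle by (simp add: complex_vector_bundle_def)

lemma openin_proj_preimage:
  "openin (base \<xi>) U \<Longrightarrow> openin (total \<xi>) {v \<in> topspace (total \<xi>). proj \<xi> v \<in> U}"
  by (rule openin_continuous_map_preimage[OF continuous_map_proj])

text \<open>A local trivialisation unpacked together with its inverse \<open>\<psi>\<close>, so that
  vectors can be produced from coordinates and each direction has its own continuity
  statement.\<close>

definition chart :: "'x set \<Rightarrow> ('e \<Rightarrow> complex ^ 'n) \<Rightarrow> ('x \<times> (complex ^ 'n) \<Rightarrow> 'e) \<Rightarrow> bool" where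
  "chart U \<phi> \<psi> \<longleftrightarrow>
    openin (base \<xi>) U \<and>
    continuous_map (subtopology (total \<xi>) {v. proj \<xi> v \<in> U}) euclidean \<phi> \<and>
    continuous_map (prod_topology (subtopology (base \<xi>) U) euclidean) (total \<xi>) \<psi> \<and>
    (\<forall>y\<in>U. \<forall>u. \<psi> (y, u) \<in> fibre \<xi> y \<and> \<phi> (\<psi> (y, u)) = u) \<and>
    (\<forall>v\<in>topspace (total \<xi>). proj \<xi> v \<in> U \<longrightarrow>
      \<psi> (proj \<xi> v, \<phi> v) = v \<and> (\<forall>c. \<phi> (smul \<xi> c v) = c *s \<phi> v))"

lemma chartD:
  assumes "chart U \<phi> \<psi>"
  shows chart_openin: "openin (base \<xi>) U"
    and chart_continuous_map: "continuous_map (subtopology (total \<xi>) {v. proj \<xi> v \<in> U}) euclidean \<phi>"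
    and chart_continuous_map_inverse:
      "continuous_map (prod_topology (subtopology (base \<xi>) U) euclidean) (total \<xi>) \<psi>"
    and chart_inverse_in_total: "y \<in> U \<Longrightarrow> \<psi> (y, u) \<in> topspace (total \<xi>)"
    and chart_proj_inverse: "y \<in> U \<Longrightarrow> proj \<xi> (\<psi> (y, u)) = y"
    and chart_right_inverse: "y \<in> U \<Longrightarrow> \<phi> (\<psi> (y, u)) = u"
    and chart_left_inverse:
      "v \<in> topspace (total \<xi>) \<Longrightarrow> proj \<xi> v \<in> U \<Longrightarrow> \<psi> (proj \<xi> v, \<phi> v) = v"
    and chart_smul:
      "v \<in> topspace (total \<xi>) \<Longrightarrow> proj \<xi> v \<in> U \<Longrightarrow> \<phi> (smul \<xi> c v) = c *s \<phi> v"
  using assms by (auto simp: chart_def fibre_def)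

lemma obtain_chart:
  assumes "x \<in> topspace (base \<xi>)"
  obtains U \<phi> \<psi> where "x \<in> U" "chart U \<phi> \<psi>"
proof -
  obtain U and \<phi> :: "'e \<Rightarrow> complex ^ 'n"
    where U: "openin (base \<xi>) U" "x \<in> U" and \<phi>: "local_trivialisation \<xi> U \<phi>"
    using vector_bundle assms unfolding complex_vector_bundle_def by blast
  let ?E = "subtopology (total \<xi>) {v. proj \<xi> v \<in> U}"
  let ?B = "prod_topology (subtopology (base \<xi>) U) (euclidean :: (complex ^ 'n) topology)"
  have "homeomorphic_map ?E ?B (\<lambda>v. (proj \<xi> v, \<phi> v))"
    using \<phi> by (simp add: local_trivialisation_def)
  then obtain \<psi> where \<psi>: "homeomorphic_maps ?E ?B (\<lambda>v. (proj \<xi> v, \<phi> v)) \<psi>"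
    unfolding homeomorphic_map_maps by blast
  then have f: "continuous_map ?E ?B (\<lambda>v. (proj \<xi> v, \<phi> v))" and g: "continuous_map ?B ?E \<psi>"
    and gf: "\<And>v. v \<in> topspace ?E \<Longrightarrow> \<psi> (proj \<xi> v, \<phi> v) = v"
    and fg: "\<And>z. z \<in> topspace ?B \<Longrightarrow> (proj \<xi> (\<psi> z), \<phi> (\<psi> z)) = z"
    by (auto simp: homeomorphic_maps_def)
  have inB: "(y, u) \<in> topspace ?B" if "y \<in> U" for y u
    using that openin_subset[OF U(1)] by auto
  have "continuous_map ?E euclidean \<phi>"
    using f by (simp add: continuous_map_pairwise o_def)
  moreover have "continuous_map ?B (total \<xi>) \<psi>"
    using g continuous_map_into_fulltopology by blast
  moreover have "\<psi> (y, u) \<in> fibre \<xi> y \<and> \<phi> (\<psi> (y, u)) = u" if "y \<in> U" for y u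
    using continuous_map_image_subset_topspace[OF g] inB[OF that, of u] fg[OF inB[OF that, of u]]
    by (auto simp: fibre_def)
  moreover have "\<psi> (proj \<xi> v, \<phi> v) = v" if "v \<in> topspace (total \<xi>)" "proj \<xi> v \<in> U" for v
    using gf that by simp
  moreover have "\<phi> (smul \<xi> c v) = c *s \<phi> v" if "v \<in> topspace (total \<xi>)" "proj \<xi> v \<in> U" for c v
    using \<phi> that in_fibre unfolding local_trivialisation_def by blast
  ultimately have "chart U \<phi> \<psi>"
    using U(1) unfolding chart_def by blast
  with U(2) show thesis
    by (rule that)
qed

text \<open>Continuity of scalar multiplication is a consequence of local triviality: in a chart the
  operation becomes \<open>(y, u) \<mapsto> (y, c *s u)\<close>.\<close>

lemma continuous_map_smul: "continuous_map (prod_topology euclidean (total \<xi>)) (total \<xi>) (\<lambda>(c, v). smul \<xi> c v)"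
proof (rule continuous_map_locally)
  fix z assume z: "z \<in> topspace (prod_topology (euclidean :: complex topology) (total \<xi>))"
  then obtain c v where cv: "z = (c, v)" "v \<in> topspace (total \<xi>)"
    by auto
  obtain U \<phi> \<psi> where U: "proj \<xi> v \<in> U" and chart: "chart U \<phi> \<psi>"
    using obtain_chart[OF proj_in_base[OF cv(2)]] .
  define V where "V = {v \<in> topspace (total \<xi>). proj \<xi> v \<in> U}"
  have V: "openin (total \<xi>) V"
    unfolding V_def using chart_openin[OF chart] by (rule openin_proj_preimage)
  let ?X = "prod_topology (euclidean :: complex topology) (subtopology (total \<xi>) V)"
  have snd: "continuous_map ?X (subtopology (total \<xi>) V) snd"
    by (rule continuous_map_snd)
  have "continuous_map (subtopology (total \<xi>) V) (subtopology (base \<xi>) U) (proj \<xi>)"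
    by (rule continuous_map_into_subtopology[OF continuous_map_from_subtopology[OF continuous_map_proj]])
      (auto simp: V_def)
  moreover have "continuous_map (subtopology (total \<xi>) V) euclidean \<phi>"
    by (rule continuous_map_from_subtopology_mono[OF chart_continuous_map[OF chart]]) (auto simp: V_def)
  ultimately have "continuous_map ?X (prod_topology (subtopology (base \<xi>) U) euclidean)
      (\<lambda>z. (proj \<xi> (snd z), fst z *s \<phi> (snd z)))"
    using snd by (intro continuous_map_pairedI continuous_map_vector_scalar_mult)
      (auto intro: continuous_map_compose[unfolded o_def] continuous_map_fst)
  then have "continuous_map ?X (total \<xi>) (\<lambda>z. \<psi> (proj \<xi> (snd z), fst z *s \<phi> (snd z)))"
    using continuous_map_compose[OF _ chart_continuous_map_inverse[OF chart]] by (simp add: o_def)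
  moreover have "\<psi> (proj \<xi> (snd z), fst z *s \<phi> (snd z)) = (case z of (c, v) \<Rightarrow> smul \<xi> c v)"
    if zX: "z \<in> topspace ?X" for z
  proof -
    obtain c v where z: "z = (c, v)" "v \<in> topspace (total \<xi>)" "proj \<xi> v \<in> U"
      using zX by (auto simp: V_def)
    have "\<psi> (proj \<xi> (smul \<xi> c v), \<phi> (smul \<xi> c v)) = smul \<xi> c v"
      using z by (intro chart_left_inverse[OF chart]) auto
    then show ?thesis
      using z chart_smul[OF chart z(2,3)] by simp
  qed
  ultimately have "continuous_map ?X (total \<xi>) (\<lambda>(c, v). smul \<xi> c v)"
    by (rule continuous_map_eq)
  moreover have "?X = subtopology (prod_topology euclidean (total \<xi>)) (UNIV \<times> V)"
    by (simp add: prod_topology_subtopology)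
  moreover have "openin (prod_topology euclidean (total \<xi>)) ((UNIV :: complex set) \<times> V)"
    using V by (simp add: openin_prod_Times_iff)
  ultimately show "\<exists>W. openin (prod_topology euclidean (total \<xi>)) W \<and> z \<in> W \<and>
      continuous_map (subtopology (prod_topology euclidean (total \<xi>)) W) (total \<xi>) (\<lambda>(c, v). smul \<xi> c v)"
    using cv U by (intro exI[of _ "UNIV \<times> V"]) (simp add: V_def)
qed

section \<open>The fibre norm\<close>

lemma metric_smul:
  assumes v: "v \<in> topspace (total \<xi>)"
  shows "h (smul \<xi> c v) (smul \<xi> c v) = c * cnj c * h v v"
proof -
  note x = proj_in_base[OF v] and f = in_fibre[OF v] smul_in_fibre[OF v, of c]
  have lin: "h (smul \<xi> c v) w = c * h v w" and herm: "h v w = cnj (h w v)"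
    if "w \<in> fibre \<xi> (proj \<xi> v)" for w
    using metric x f that unfolding hermitian_metric_def by metis+
  \<comment> \<open>The second argument is reached by symmetry, which costs a conjugation; the
    conjugate left on \<open>h v v\<close> disappears because that value is real.\<close>
  have "h (smul \<xi> c v) (smul \<xi> c v) = c * cnj (c * h v v)"
    using lin[OF f(2)] herm[OF f(2)] lin[OF f(1)] by simp
  then show ?thesis
    using herm[OF f(1)] by simp
qed

lemma fnorm_smul:
  assumes v: "v \<in> topspace (total \<xi>)"
  shows "fnorm h (smul \<xi> c v) = cmod c * fnorm h v"
proof -
  have "Re (h (smul \<xi> c v) (smul \<xi> c v)) = (cmod c)\<^sup>2 * Re (h v v)"
    by (simp add: metric_smul[OF v] complex_norm_square[symmetric] flip: of_real_power)
  then show ?thesis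
    by (simp add: fnorm_def real_sqrt_mult)
qed

lemma fnorm_vzero [simp]:
  assumes "x \<in> topspace (base \<xi>)"
  shows "fnorm h (vzero \<xi> x) = 0"
  using assms fnorm_smul[of "vzero \<xi> x" 0] by simp

lemma fnorm_pos:
  assumes "v \<in> topspace (total \<xi>)" "v \<noteq> vzero \<xi> (proj \<xi> v)"
  shows "fnorm h v > 0"
  using metric assms proj_in_base in_fibre unfolding hermitian_metric_def fnorm_def
  by (metis real_sqrt_gt_0_iff)

lemma fnorm_eq_0_iff:
  "v \<in> topspace (total \<xi>) \<Longrightarrow> fnorm h v = 0 \<longleftrightarrow> v = vzero \<xi> (proj \<xi> v)"
  using fnorm_pos[of v] fnorm_vzero[OF proj_in_base, of v] by (metis less_irrefl)

lemma continuous_map_fnorm: "continuous_map (total \<xi>) euclideanreal (fnorm h)"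
proof -
  \<comment> \<open>The diagonal lands in the fibre product, where the metric is continuous.\<close>
  have "continuous_map (total \<xi>)
      (subtopology (prod_topology (total \<xi>) (total \<xi>)) {(v, w). proj \<xi> v = proj \<xi> w}) (\<lambda>v. (v, v))"
    by (intro continuous_map_into_subtopology continuous_map_pairedI continuous_map_id[unfolded id_def]) auto
  moreover have "continuous_map
      (subtopology (prod_topology (total \<xi>) (total \<xi>)) {(v, w). proj \<xi> v = proj \<xi> w})
      euclidean (\<lambda>(v, w). h v w)"
    using metric by (simp add: hermitian_metric_def)
  ultimately have "continuous_map (total \<xi>) euclidean (\<lambda>v. h v v)"
    using continuous_map_compose by (fastforce simp: o_def)
  then show ?thesis
    unfolding fnorm_def[abs_def] continuous_map_atin limitin_canonical_iff
    by (intro ballI tendsto_real_sqrt tendsto_Re) auto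
qed

end

section \<open>The map from lines to the sphere\<close>

text \<open>On unit vectors in rank one this is the Hopf fibration of the 3-sphere over the
  2-sphere. It is defined on vectors, not on lines, so that its continuity can be checked on the
  total space before passing to the quotient.\<close>

definition hopf_map :: "('e, 'x) cbundle \<Rightarrow> ('e \<Rightarrow> 'e \<Rightarrow> complex) \<Rightarrow> 'e \<times> complex \<Rightarrow> 'e \<times> real" where
  "hopf_map \<xi> h = (\<lambda>(v, a).
     (smul \<xi> (2 * cnj a / complex_of_real ((fnorm h v)\<^sup>2 + (cmod a)\<^sup>2)) v,
      ((fnorm h v)\<^sup>2 - (cmod a)\<^sup>2) / ((fnorm h v)\<^sup>2 + (cmod a)\<^sup>2)))"

context hermitian_bundle
begin

interpretation plus: vector_space_family "plus_C \<xi>"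
  by (rule plus_C_family)

section \<open>Values, section and fibres of \<open>hopf_map\<close>\<close>

lemma mem_sph_compactification:
  "(w, t) \<in> topspace (sph_compactification \<xi> h) \<longleftrightarrow>
    w \<in> topspace (total \<xi>) \<and> (fnorm h w)\<^sup>2 + t\<^sup>2 = 1"
  by (simp add: sph_compactification_def fnorm_plus_R_def)

lemma pole_in_sph_compactification:
  "x \<in> topspace (base \<xi>) \<Longrightarrow> t\<^sup>2 = 1 \<Longrightarrow> (vzero \<xi> x, t) \<in> topspace (sph_compactification \<xi> h)"
  by (simp add: mem_sph_compactification)

lemma sph_compactification_pole:
  assumes "(w, t) \<in> topspace (sph_compactification \<xi> h)" "t\<^sup>2 = 1"
  shows "w = vzero \<xi> (proj \<xi> w)"
  using assms fnorm_eq_0_iff[of w] by (simp add: mem_sph_compactification)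

lemma hopf_denominator_pos:
  assumes "(v, a) \<in> nonzero_vectors (plus_C \<xi>)"
  shows "(fnorm h v)\<^sup>2 + (cmod a)\<^sup>2 > 0"
  using assms fnorm_pos[of v] by (auto intro: add_pos_nonneg add_nonneg_pos)

text \<open>Both components are homogeneous of degree zero: \<open>cnj c\<close> from the
  coefficient and \<open>c\<close> from the vector combine to \<open>|c|^2\<close>, the factor
  gained by the denominator.\<close>

lemma hopf_map_smul:
  assumes v: "v \<in> topspace (total \<xi>)" and c: "c \<noteq> 0"
  shows "hopf_map \<xi> h (smul \<xi> c v, c * a) = hopf_map \<xi> h (v, a)"
proof -
  let ?N = "(fnorm h v)\<^sup>2" and ?A = "(cmod a)\<^sup>2"
  have sum: "(fnorm h (smul \<xi> c v))\<^sup>2 + (cmod (c * a))\<^sup>2 = (cmod c)\<^sup>2 * (?N + ?A)"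
    and diff: "(fnorm h (smul \<xi> c v))\<^sup>2 - (cmod (c * a))\<^sup>2 = (cmod c)\<^sup>2 * (?N - ?A)"
    by (simp_all add: fnorm_smul[OF v] norm_mult power_mult_distrib algebra_simps)
  have "2 * cnj (c * a) / complex_of_real ((cmod c)\<^sup>2 * (?N + ?A)) * c
      = (c * cnj c) * (2 * cnj a) / ((c * cnj c) * complex_of_real (?N + ?A))"
    by (simp only: of_real_mult complex_norm_square) simp
  also have "\<dots> = 2 * cnj a / complex_of_real (?N + ?A)"
    by (rule mult_divide_mult_cancel_left) (use c in simp)
  finally have "smul \<xi> (2 * cnj (c * a) / complex_of_real ((cmod c)\<^sup>2 * (?N + ?A))) (smul \<xi> c v)
      = smul \<xi> (2 * cnj a / complex_of_real (?N + ?A)) v"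
    by (simp only: smul_smul[OF v])
  moreover have "(cmod c)\<^sup>2 * (?N - ?A) / ((cmod c)\<^sup>2 * (?N + ?A)) = (?N - ?A) / (?N + ?A)"
    by (rule mult_divide_mult_cancel_left) (use c in simp)
  ultimately show ?thesis
    by (simp only: hopf_map_def prod.case sum diff)
qed

lemma hopf_map_zero:
  assumes "v \<in> topspace (total \<xi>)" "v \<noteq> vzero \<xi> (proj \<xi> v)"
  shows "hopf_map \<xi> h (v, 0) = (vzero \<xi> (proj \<xi> v), 1)"
  using assms fnorm_pos[of v] by (simp add: hopf_map_def)

lemma snd_hopf_map_eq_1_iff:
  assumes "(v, a) \<in> nonzero_vectors (plus_C \<xi>)"
  shows "snd (hopf_map \<xi> h (v, a)) = 1 \<longleftrightarrow> a = 0"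
  using hopf_denominator_pos[OF assms] by (auto simp: hopf_map_def field_simps)

lemma proj_hopf_map:
  "v \<in> topspace (total \<xi>) \<Longrightarrow> proj \<xi> (fst (hopf_map \<xi> h (v, a))) = proj \<xi> v"
  by (simp add: hopf_map_def)

text \<open>With \<open>N\<close> and \<open>A\<close> the squared norms of the two entries, this is
  the identity \<open>4 A N + (N - A)^2 = (N + A)^2\<close>.\<close>

lemma hopf_map_in_sph_compactification:
  assumes va: "(v, a) \<in> nonzero_vectors (plus_C \<xi>)"
  shows "hopf_map \<xi> h (v, a) \<in> topspace (sph_compactification \<xi> h)"
proof -
  have v: "v \<in> topspace (total \<xi>)"
    using va by simp
  define N A where "N = (fnorm h v)\<^sup>2" and "A = (cmod a)\<^sup>2"
  have s: "N + A > 0"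
    using hopf_denominator_pos[OF va] by (simp add: N_def A_def)
  have "(cmod (2 * cnj a / complex_of_real (N + A)))\<^sup>2 = 4 * A / (N + A)\<^sup>2"
    by (simp add: norm_mult norm_divide power_divide power_mult_distrib A_def del: of_real_add)
  then have "(fnorm h (fst (hopf_map \<xi> h (v, a))))\<^sup>2 + (snd (hopf_map \<xi> h (v, a)))\<^sup>2
      = (4 * A / (N + A)\<^sup>2) * N + ((N - A) / (N + A))\<^sup>2"
    by (simp add: hopf_map_def fnorm_smul[OF v] power_mult_distrib del: of_real_add flip: N_def A_def)
  also have "\<dots> = (4 * A * N + (N - A)\<^sup>2) / (N + A)\<^sup>2"
    by (simp add: power_divide add_divide_distrib)
  also have "4 * A * N + (N - A)\<^sup>2 = (N + A)\<^sup>2"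
    by algebra
  finally show ?thesis
    using s v by (simp add: hopf_map_def mem_sph_compactification)
qed

text \<open>Stereographic projection from \<open>(0, 1)\<close> is \<open>w / (1 - t)\<close>, and
  \<open>(w, 1 - t)\<close> spans the corresponding line without a denominator. On the sphere
  \<open>|w|^2 + (1 - t)^2 = 2 (1 - t)\<close>, which makes the coefficient of \<open>w\<close> in
  \<open>hopf_map\<close> exactly 1.\<close>

lemma hopf_map_section:
  assumes wt: "(w, t) \<in> topspace (sph_compactification \<xi> h)" and t: "t \<noteq> 1"
  shows "(w, complex_of_real (1 - t)) \<in> nonzero_vectors (plus_C \<xi>)"
    and "hopf_map \<xi> h (w, complex_of_real (1 - t)) = (w, t)"
proof -
  have w: "w \<in> topspace (total \<xi>)" and N: "(fnorm h w)\<^sup>2 = 1 - t\<^sup>2"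
    using wt by (auto simp: mem_sph_compactification)
  show "(w, complex_of_real (1 - t)) \<in> nonzero_vectors (plus_C \<xi>)"
    using w t by (simp del: of_real_diff)
  have A: "(cmod (complex_of_real (1 - t)))\<^sup>2 = (1 - t)\<^sup>2"
    by (simp only: norm_of_real power2_abs)
  have s: "1 - t\<^sup>2 + (1 - t)\<^sup>2 = 2 * (1 - t)" and d: "1 - t\<^sup>2 - (1 - t)\<^sup>2 = t * (2 * (1 - t))"
    by (simp_all add: power2_eq_square algebra_simps)
  have "2 * cnj (complex_of_real (1 - t)) / complex_of_real (2 * (1 - t)) = 1"
    using t by simp
  then show "hopf_map \<xi> h (w, complex_of_real (1 - t)) = (w, t)"
    unfolding hopf_map_def prod.case N A s d using w t by simp
qed

text \<open>The factor is the coefficient of \<open>v\<close> in \<open>hopf_map\<close>; it also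
  relates the second entries, since \<open>1 - (N - A) / (N + A) = 2 A / (N + A)\<close> and
  \<open>A = a * cnj a\<close>.\<close>

lemma section_hopf_map:
  assumes va: "(v, a) \<in> nonzero_vectors (plus_C \<xi>)" and a: "a \<noteq> 0"
  obtains c where "c \<noteq> 0"
    "(fst (hopf_map \<xi> h (v, a)), complex_of_real (1 - snd (hopf_map \<xi> h (v, a)))) =
      smul (plus_C \<xi>) c (v, a)"
proof
  define s where "s = (fnorm h v)\<^sup>2 + (cmod a)\<^sup>2"
  have s: "s > 0"
    using hopf_denominator_pos[OF va] by (simp add: s_def)
  let ?c = "2 * cnj a / complex_of_real s"
  show "?c \<noteq> 0"
    using a s by simp
  have hopf: "hopf_map \<xi> h (v, a) = (smul \<xi> ?c v, ((fnorm h v)\<^sup>2 - (cmod a)\<^sup>2) / s)"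
    by (simp only: hopf_map_def prod.case s_def)
  have "1 - snd (hopf_map \<xi> h (v, a)) = 2 * (cmod a)\<^sup>2 / s"
    using s by (simp add: hopf diff_divide_eq_iff) (simp add: s_def)
  moreover have "complex_of_real (2 * (cmod a)\<^sup>2 / s) = ?c * a"
    by (simp add: complex_norm_square mult.commute del: of_real_power)
  ultimately show "(fst (hopf_map \<xi> h (v, a)), complex_of_real (1 - snd (hopf_map \<xi> h (v, a)))) =
      smul (plus_C \<xi>) ?c (v, a)"
    by (simp only: hopf fst_conv smul_plus_C)
qed

text \<open>For \<open>a \<noteq> 0\<close> the image determines the line through the section; for
  \<open>a = 0\<close> only the base point survives in the image.\<close>

lemma hopf_map_eq_iff:
  assumes z: "(v, a) \<in> nonzero_vectors (plus_C \<xi>)" and z': "(v', a') \<in> nonzero_vectors (plus_C \<xi>)"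
  shows "hopf_map \<xi> h (v, a) = hopf_map \<xi> h (v', a') \<longleftrightarrow>
    line (plus_C \<xi>) (v, a) = line (plus_C \<xi>) (v', a') \<or> a = 0 \<and> a' = 0 \<and> proj \<xi> v = proj \<xi> v'"
    (is "?L \<longleftrightarrow> ?R")
proof
  have v: "v \<in> topspace (total \<xi>)" "v' \<in> topspace (total \<xi>)"
    using z z' by simp_all
  {
    assume ?L
    then have "proj \<xi> v = proj \<xi> v'" and a: "a = 0 \<longleftrightarrow> a' = 0"
      using proj_hopf_map[of v] proj_hopf_map[of v'] v snd_hopf_map_eq_1_iff[OF z]
        snd_hopf_map_eq_1_iff[OF z'] by metis+
    show ?R
    proof (cases "a = 0")
      case False
      obtain c where c: "c \<noteq> 0" "(fst (hopf_map \<xi> h (v, a)), complex_of_real (1 - snd (hopf_map \<xi> h (v, a)))) =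
        smul (plus_C \<xi>) c (v, a)"
        by (rule section_hopf_map[OF z False])
      obtain c' where c': "c' \<noteq> 0" "(fst (hopf_map \<xi> h (v', a')), complex_of_real (1 - snd (hopf_map \<xi> h (v', a')))) =
        smul (plus_C \<xi>) c' (v', a')"
        using section_hopf_map[OF z'] False a by blast
      have "line (plus_C \<xi>) (v, a) = line (plus_C \<xi>) (smul (plus_C \<xi>) c (v, a))"
        using v c(1) by (intro plus.line_smul[symmetric]) auto
      also have "smul (plus_C \<xi>) c (v, a) = smul (plus_C \<xi>) c' (v', a')"
        using c(2) c'(2) \<open>?L\<close> by metis
      also have "line (plus_C \<xi>) \<dots> = line (plus_C \<xi>) (v', a')"
        using v c'(1) by (intro plus.line_smul) auto
      finally show ?thesis ..
    qed (use a \<open>proj \<xi> v = proj \<xi> v'\<close> in auto)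
  next
    assume ?R
    then show ?L
    proof
      assume "line (plus_C \<xi>) (v, a) = line (plus_C \<xi>) (v', a')"
      then obtain c where "c \<noteq> 0" "(v', a') = smul (plus_C \<xi>) c (v, a)"
        using plus.line_eq_obtains[of "(v, a)" "(v', a')"] v z' by auto
      then show ?L
        using hopf_map_smul v by simp
    next
      assume "a = 0 \<and> a' = 0 \<and> proj \<xi> v = proj \<xi> v'"
      then show ?L
        using z z' hopf_map_zero by simp
    qed
  }
qed

lemma continuous_map_hopf_map:
  "continuous_map (subtopology (total (plus_C \<xi>)) (nonzero_vectors (plus_C \<xi>)))
    (sph_compactification \<xi> h) (hopf_map \<xi> h)"
proof -
  define Z where "Z = subtopology (total (plus_C \<xi>)) (nonzero_vectors (plus_C \<xi>))"
  define N where "N z = (fnorm h (fst z))\<^sup>2" for z :: "'e \<times> complex"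
  define A where "A z = (cmod (snd z))\<^sup>2" for z :: "'e \<times> complex"
  have fst: "continuous_map Z (total \<xi>) fst" and snd: "continuous_map Z euclidean snd"
    unfolding Z_def total_plus_C
    by (intro continuous_map_from_subtopology continuous_map_fst continuous_map_snd)+
  have N: "continuous_map Z euclideanreal N"
    unfolding N_def using continuous_map_compose[OF fst continuous_map_fnorm]
    by (intro continuous_map_real_pow) (simp add: o_def)
  have A: "continuous_map Z euclideanreal A"
    unfolding A_def using snd by (intro continuous_map_real_pow continuous_map_norm)
  have pos: "N z + A z \<noteq> 0" if "z \<in> topspace Z" for z
    using that hopf_denominator_pos[of "fst z" "snd z"] by (auto simp: Z_def N_def A_def)
  have NA: "continuous_map Z euclideanreal (\<lambda>z. N z + A z)"
    using N A by (rule continuous_map_add)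
  have "continuous_map Z euclidean (\<lambda>z. 2 * cnj (snd z) / complex_of_real (N z + A z))"
    using snd NA pos unfolding continuous_map_atin limitin_canonical_iff
    by (intro ballI tendsto_divide tendsto_mult tendsto_const tendsto_cnj tendsto_of_real)
      (auto simp del: of_real_add)
  then have "continuous_map Z (prod_topology euclidean (total \<xi>))
      (\<lambda>z. (2 * cnj (snd z) / complex_of_real (N z + A z), fst z))"
    using fst by (rule continuous_map_pairedI)
  from continuous_map_compose[OF this continuous_map_smul]
  have "continuous_map Z (total \<xi>) (\<lambda>z. smul \<xi> (2 * cnj (snd z) / complex_of_real (N z + A z)) (fst z))"
    by (simp add: o_def)
  moreover have "continuous_map Z euclideanreal (\<lambda>z. (N z - A z) / (N z + A z))"
    using N A NA pos by (intro continuous_map_real_divide continuous_map_diff)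
  ultimately have "continuous_map Z (prod_topology (total \<xi>) euclideanreal)
      (\<lambda>z. (smul \<xi> (2 * cnj (snd z) / complex_of_real (N z + A z)) (fst z), (N z - A z) / (N z + A z)))"
    by (rule continuous_map_pairedI)
  then have "continuous_map Z (prod_topology (total \<xi>) euclideanreal) (hopf_map \<xi> h)"
    by (simp add: hopf_map_def N_def A_def case_prod_unfold)
  moreover have "hopf_map \<xi> h z \<in> {z. fnorm_plus_R h z = 1}" if "z \<in> topspace Z" for z
    using that hopf_map_in_sph_compactification[of "fst z" "snd z"]
    by (simp add: Z_def sph_compactification_def)
  ultimately have "continuous_map Z (sph_compactification \<xi> h) (hopf_map \<xi> h)"
    unfolding sph_compactification_def by (intro continuous_map_into_subtopology) auto
  then show ?thesis
    by (simp add: Z_def)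
qed

section \<open>Neighbourhoods of the pole \<open>(0, 1)\<close>\<close>

lemma chart_inverse_nonzero:
  assumes "chart U \<phi> \<psi>" "y \<in> U" "u \<noteq> 0"
  shows "\<psi> (y, u) \<noteq> vzero \<xi> y"
proof
  note chart = chartD[OF assms(1)]
  assume eq: "\<psi> (y, u) = vzero \<xi> y"
  \<comment> \<open>The zero vector is fixed by the scalar 0, so its coordinate is 0.\<close>
  have "\<phi> (smul \<xi> 0 (\<psi> (y, u))) = 0 *s \<phi> (\<psi> (y, u))"
    using assms(2) chart by metis
  moreover have "smul \<xi> 0 (\<psi> (y, u)) = \<psi> (y, u)"
    using smul_0[OF chart(4)[OF assms(2), of u]] chart(5)[OF assms(2), of u] eq by metis
  ultimately show False
    using chart(6)[OF assms(2), of u] assms(3) by simp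
qed

lemma chart_eq_0_iff:
  assumes "chart U \<phi> \<psi>" "v \<in> topspace (total \<xi>)" "proj \<xi> v \<in> U"
  shows "\<phi> v = 0 \<longleftrightarrow> v = vzero \<xi> (proj \<xi> v)"
proof
  assume "\<phi> v = 0"
  then have "\<phi> (smul \<xi> 0 v) = \<phi> v"
    using chart_smul[OF assms, of 0] by simp
  then have "smul \<xi> 0 v = v"
    using chart_left_inverse[OF assms] chart_left_inverse[OF assms(1), of "smul \<xi> 0 v"] assms(2,3)
    by (metis proj_smul smul_in_total)
  then show "v = vzero \<xi> (proj \<xi> v)"
    using assms(2) by simp
next
  assume "v = vzero \<xi> (proj \<xi> v)"
  then have "\<phi> v = \<phi> (smul \<xi> 0 v)"
    using assms(2) by simp
  also have "\<dots> = 0"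
    using chart_smul[OF assms, of 0] by simp
  finally show "\<phi> v = 0" .
qed

text \<open>The coordinate \<open>\<phi>\<close> is continuous only over \<open>U\<close>; openness
  inside the part over \<open>O'\<close> passes to the total space because that part is itself
  open.\<close>

lemma openin_chart_preimage:
  assumes chart: "chart U \<phi> \<psi>" and O: "openin (base \<xi>) O'" "O' \<subseteq> U" and G: "open G"
  shows "openin (total \<xi>) {v \<in> topspace (total \<xi>). proj \<xi> v \<in> O' \<and> \<phi> v \<in> G}"
proof -
  define V where "V = {v \<in> topspace (total \<xi>). proj \<xi> v \<in> O'}"
  have V: "openin (total \<xi>) V"
    unfolding V_def using O(1) by (rule openin_proj_preimage)
  have "continuous_map (subtopology (total \<xi>) V) euclidean \<phi>"
    by (rule continuous_map_from_subtopology_mono[OF chart_continuous_map[OF chart]])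
      (use O(2) in \<open>auto simp: V_def\<close>)
  then have "openin (subtopology (total \<xi>) V) {v \<in> topspace (subtopology (total \<xi>) V). \<phi> v \<in> G}"
    using G by (intro openin_continuous_map_preimage) auto
  then have "openin (total \<xi>) {v \<in> topspace (subtopology (total \<xi>) V). \<phi> v \<in> G}"
    using V by (simp add: openin_open_subtopology)
  moreover have "{v \<in> topspace (subtopology (total \<xi>) V). \<phi> v \<in> G}
      = {v \<in> topspace (total \<xi>). proj \<xi> v \<in> O' \<and> \<phi> v \<in> G}"
    by (auto simp: V_def)
  ultimately show ?thesis by simp
qed

text \<open>The preimage of a pole \<open>(0, 1)\<close> is a whole projective space, which is compact; the tube lemma
  therefore applies to the unit sphere of a chart.\<close>

lemma hopf_map_neighbourhood_of_pole:
  fixes W :: "('e \<times> real) set"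
  defines "Z \<equiv> subtopology (total (plus_C \<xi>)) (nonzero_vectors (plus_C \<xi>))"
  assumes P: "openin Z {z \<in> topspace Z. hopf_map \<xi> h z \<in> W}"
    and x: "x \<in> topspace (base \<xi>)" and W: "(vzero \<xi> x, 1) \<in> W"
  obtains T where "openin (sph_compactification \<xi> h) T" "(vzero \<xi> x, 1) \<in> T" "T \<subseteq> W"
proof -
  obtain U \<phi> \<psi> where xU: "x \<in> U" and chart: "chart U \<phi> \<psi>"
    using obtain_chart[OF x] .
  note U = chart_openin[OF chart]
  \<comment> \<open>The unit sphere is taken in chart coordinates and not for \<open>h\<close>: it
    is then one fixed compact set, independent of the base point. Via \<open>k\<close> and at
    \<open>a = 0\<close> its vectors represent every line at infinity over \<open>x\<close>.\<close>
  define S where "S = sphere (0 :: complex ^ 'n) 1"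
  define B where "B = subtopology (base \<xi>) U"
  define X where "X = prod_topology B (euclidean :: complex topology)"
  define k where "k = (\<lambda>((y, a), u). (\<psi> (y, u), a :: complex))"
  define \<Omega> where "\<Omega> =
    {p \<in> topspace (prod_topology X (top_of_set S)). k p \<in> {z \<in> topspace Z. hopf_map \<xi> h z \<in> W}}"
  have topB: "topspace B = U"
    using openin_subset[OF U] by (auto simp: B_def)
  have topX: "topspace (prod_topology X (top_of_set S)) = (U \<times> UNIV) \<times> S"
    by (simp add: X_def topB)
  have S: "compactin (top_of_set S) S" and S0: "\<And>u. u \<in> S \<Longrightarrow> u \<noteq> 0"
    by (auto simp: S_def compactin_subtopology)
  have psi_nz: "(\<psi> (y, u), a) \<in> topspace Z" if "y \<in> U" "u \<in> S" for y u a
    using that chart_inverse_in_total[OF chart] chart_inverse_nonzero[OF chart _ S0]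
      chart_proj_inverse[OF chart] by (simp add: Z_def)
  have fst1: "continuous_map (prod_topology X (top_of_set S)) B (\<lambda>z. fst (fst z))"
    and snd1: "continuous_map (prod_topology X (top_of_set S)) euclidean (\<lambda>z. snd (fst z))"
    unfolding X_def
    using continuous_map_compose[OF continuous_map_fst continuous_map_fst]
      continuous_map_compose[OF continuous_map_fst continuous_map_snd] by (auto simp: o_def)
  have "continuous_map (prod_topology X (top_of_set S)) (prod_topology B euclidean)
      (\<lambda>z. (fst (fst z), snd z))"
    by (intro continuous_map_pairedI fst1 continuous_map_into_fulltopology[OF continuous_map_snd])
  from continuous_map_compose[OF this[unfolded B_def] chart_continuous_map_inverse[OF chart]]
  have "continuous_map (prod_topology X (top_of_set S)) (prod_topology (total \<xi>) euclidean)
      (\<lambda>z. (\<psi> (fst (fst z), snd z), snd (fst z)))"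
    using snd1 by (intro continuous_map_pairedI) (simp_all add: o_def B_def)
  then have "continuous_map (prod_topology X (top_of_set S)) Z k"
    unfolding Z_def total_plus_C
  proof (intro continuous_map_into_subtopology)
    show "k \<in> topspace (prod_topology X (top_of_set S)) \<rightarrow> nonzero_vectors (plus_C \<xi>)"
      using psi_nz unfolding topX by (auto simp: k_def Z_def)
  qed (simp add: k_def case_prod_unfold)
  then have open_\<Omega>: "openin (prod_topology X (top_of_set S)) \<Omega>"
    unfolding \<Omega>_def using P by (rule openin_continuous_map_preimage)
  have "k ((x, 0), u) \<in> {z \<in> topspace Z. hopf_map \<xi> h z \<in> W}" if "u \<in> S" for u
    using that xU W psi_nz chart_inverse_in_total[OF chart] chart_inverse_nonzero[OF chart _ S0]
      chart_proj_inverse[OF chart] hopf_map_zero[of "\<psi> (x, u)"]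
    by (simp add: k_def)
  then have sub_\<Omega>: "{(x, 0)} \<times> S \<subseteq> \<Omega>"
    using xU unfolding \<Omega>_def topX by blast
  have x0: "(x, 0) \<in> topspace X"
    using xU by (simp add: X_def topB)
  \<comment> \<open>The tube lemma yields bounds on the base point and on \<open>a\<close> that work
    for all directions \<open>u\<close> at once.\<close>
  obtain A V where A: "openin X A" "(x, 0) \<in> A" and V: "S \<subseteq> V" and AV: "A \<times> V \<subseteq> \<Omega>"
    using tube_lemma_right[OF open_\<Omega> S x0 sub_\<Omega>] by blast
  obtain A1 A2 where A1: "openin B A1" "x \<in> A1" and A2: "open A2" "0 \<in> A2" and "A1 \<times> A2 \<subseteq> A"
    using A unfolding X_def openin_prod_topology_alt by (metis open_openin)
  obtain \<delta> where \<delta>: "\<delta> > 0" "ball 0 \<delta> \<subseteq> A2"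
    using A2 openE by blast
  have inW: "hopf_map \<xi> h (\<psi> (y, u), a) \<in> W" if "y \<in> A1" "u \<in> S" "cmod a < \<delta>" for y u a
  proof -
    have "((y, a), u) \<in> A \<times> V"
      using that \<delta>(2) \<open>A1 \<times> A2 \<subseteq> A\<close> V by (auto simp: subset_iff)
    then show ?thesis
      using AV by (auto simp: \<Omega>_def k_def)
  qed

  \<comment> \<open>A second tube argument bounds the \<open>h\<close>-norm by the chart norm
    uniformly near \<open>x\<close>; this is needed because points of the sphere bundle are
    normalised by \<open>h\<close>, but directions by the chart.\<close>
  define g where "g = (\<lambda>(y, u). (fnorm h (\<psi> (y, u)))\<^sup>2)"
  have "continuous_map (prod_topology B (top_of_set S)) (prod_topology B euclidean) (\<lambda>z. (fst z, snd z))"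
    by (intro continuous_map_pairedI continuous_map_fst continuous_map_into_fulltopology[OF continuous_map_snd])
  from continuous_map_compose[OF continuous_map_compose[OF this[unfolded B_def]
        chart_continuous_map_inverse[OF chart]] continuous_map_fnorm]
  have g: "continuous_map (prod_topology B (top_of_set S)) euclideanreal g"
    unfolding g_def case_prod_unfold by (intro continuous_map_real_pow) (simp add: o_def B_def)
  have "compactin (prod_topology B (top_of_set S)) ({x} \<times> S)"
    using S xU topB by (simp add: compactin_Times)
  then have "compact (g ` ({x} \<times> S))"
    using image_compactin[OF _ g] by simp
  then obtain b where b: "b > 0" "\<And>r. r \<in> g ` ({x} \<times> S) \<Longrightarrow> norm r \<le> b"
    using compact_imp_bounded bounded_pos by metis
  \<comment> \<open>The extra 1 makes the bound strict, hence an open condition that persists near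
    \<open>x\<close>.\<close>
  define C where "C = b + 1"
  have C: "C > 0" and gC: "g (x, u) < C" if "u \<in> S" for u
    using b(1) b(2)[of "g (x, u)"] that by (auto simp: C_def)
  define \<Omega>' where "\<Omega>' = {p \<in> topspace (prod_topology B (top_of_set S)). g p \<in> {..<C}}"
  have open_\<Omega>': "openin (prod_topology B (top_of_set S)) \<Omega>'"
    unfolding \<Omega>'_def using g by (rule openin_continuous_map_preimage) simp
  have sub_\<Omega>': "{x} \<times> S \<subseteq> \<Omega>'"
    using xU gC by (auto simp: \<Omega>'_def topB)
  have xB: "x \<in> topspace B"
    using xU by (simp add: topB)
  obtain D V' where D: "openin B D" "x \<in> D" and V': "S \<subseteq> V'"
    and DV: "D \<times> V' \<subseteq> \<Omega>'"
    using tube_lemma_right[OF open_\<Omega>' S xB sub_\<Omega>'] by blast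
  have gD: "(fnorm h (\<psi> (y, u)))\<^sup>2 < C" if "y \<in> D" "u \<in> S" for y u
    using DV V' that by (auto simp: \<Omega>'_def g_def)

  define O' where "O' = A1 \<inter> D"
  have O': "openin (base \<xi>) O'" "O' \<subseteq> U" "x \<in> O'"
    using A1 D U by (auto simp: O'_def B_def openin_open_subtopology)
  \<comment> \<open>The threshold anticipates the estimate \<open>(1 - t) / r < r * C\<close> with
    \<open>r = norm (\<phi> w)\<close>, whose right side must stay below
    \<open>\<delta>\<close>.\<close>
  define N where "N = {v \<in> topspace (total \<xi>). proj \<xi> v \<in> O' \<and> \<phi> v \<in> {u. C * norm u < \<delta>}}"
  have "open {u :: complex ^ 'n. C * norm u < \<delta>}"
    by (intro open_Collect_less continuous_intros)
  then have N: "openin (total \<xi>) N"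
    unfolding N_def using openin_chart_preimage[OF chart O'(1,2)] by blast
  \<comment> \<open>The condition \<open>t > 0\<close> excludes the opposite pole, near which
    \<open>w\<close> is small as well, and gives \<open>1 - t \<le> 1 - t^2\<close>.\<close>
  define T where "T = (N \<times> {0<..}) \<inter> topspace (sph_compactification \<xi> h)"
  show thesis
  proof
    have "openin (prod_topology (total \<xi>) euclideanreal) (N \<times> {0<..})"
      using N by (simp add: openin_prod_Times_iff)
    then have "openin (sph_compactification \<xi> h) ((N \<times> {0<..}) \<inter> {z. fnorm_plus_R h z = 1})"
      unfolding sph_compactification_def by (rule openin_subtopology_Int)
    moreover have "(N \<times> {0<..}) \<inter> {z. fnorm_plus_R h z = 1} = T"
      using openin_subset[OF N] by (auto simp: T_def sph_compactification_def)
    ultimately show "openin (sph_compactification \<xi> h) T"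
      by simp
    have "\<phi> (vzero \<xi> x) = 0"
      using chart_eq_0_iff[OF chart, of "vzero \<xi> x"] x xU by simp
    then show "(vzero \<xi> x, 1) \<in> T"
      using x O'(3) \<delta>(1) pole_in_sph_compactification[OF x, of 1] by (simp add: T_def N_def)
    show "T \<subseteq> W"
    proof (rule subrelI)
      fix w t assume "(w, t) \<in> T"
      then have wt: "(w, t) \<in> topspace (sph_compactification \<xi> h)" and "t > 0"
        and w: "w \<in> topspace (total \<xi>)" "proj \<xi> w \<in> O'" and small: "C * norm (\<phi> w) < \<delta>"
        by (auto simp: T_def N_def)
      have y: "proj \<xi> w \<in> A1" "proj \<xi> w \<in> D" "proj \<xi> w \<in> U"
        using w(2) O'(2) by (auto simp: O'_def)
      have sq: "(fnorm h w)\<^sup>2 + t\<^sup>2 = 1"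
        using wt by (simp add: mem_sph_compactification)
      show "(w, t) \<in> W"
      proof (cases "w = vzero \<xi> (proj \<xi> w)")
        case True
        then have "fnorm h w = 0"
          using fnorm_eq_0_iff[OF w(1)] by simp
        then have "t = 1"
          using sq \<open>t > 0\<close> by (simp add: power2_eq_1_iff)
        \<comment> \<open>At the pole itself there is no direction to normalise; any line at
          infinity over this base point will do.\<close>
        obtain e :: "complex ^ 'n" where e: "e \<in> S"
          using vector_choose_size[of 1] by (auto simp: S_def)
        have "hopf_map \<xi> h (\<psi> (proj \<xi> w, e), 0) = (vzero \<xi> (proj \<xi> w), 1)"
          using hopf_map_zero[of "\<psi> (proj \<xi> w, e)"] chart_inverse_in_total[OF chart y(3)]
            chart_inverse_nonzero[OF chart y(3) S0[OF e]] chart_proj_inverse[OF chart y(3)] by simp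
        then show ?thesis
          using inW[OF y(1) e, of 0] \<delta>(1) True \<open>t = 1\<close> by simp
      next
        case False
        define r where "r = norm (\<phi> w)"
        have r: "r > 0"
          using False chart_eq_0_iff[OF chart w(1) y(3)] by (simp add: r_def)
        have "t \<noteq> 1"
          using sq False fnorm_eq_0_iff[OF w(1)] by auto
        define u where "u = complex_of_real (1 / r) *s \<phi> w"
        have u: "u \<in> S"
          unfolding S_def u_def using r by (simp add: norm_of_real_scalar_mult del: of_real_divide) (simp add: r_def)
        \<comment> \<open>Rescaling the section value \<open>(w, 1 - t)\<close> by
          \<open>1 / r\<close> gives a vector of the same line whose first entry is a unit vector in
          the chart and so falls under \<open>inW\<close>.\<close>
        define v where "v = smul \<xi> (complex_of_real (1 / r)) w"
        have v: "\<psi> (proj \<xi> w, u) = v"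
          using chart_left_inverse[OF chart, of v] chart_smul[OF chart w(1) y(3)] w(1) y(3)
          by (simp add: v_def u_def)
        have "(fnorm h w)\<^sup>2 = r\<^sup>2 * (fnorm h v)\<^sup>2"
          using r by (simp add: v_def fnorm_smul[OF w(1)] power_mult_distrib power_divide norm_divide)
        also have "\<dots> < r\<^sup>2 * C"
          using gD[OF y(2) u] r by (simp add: v)
        finally have "1 - t\<^sup>2 < r\<^sup>2 * C"
          using sq by simp
        moreover have t1: "t \<le> 1"
          using sq by (metis abs_le_square_iff abs_le_D1 le_add_same_cancel2 one_power2 zero_le_power2 abs_one)
        then have "1 - t \<le> 1 - t\<^sup>2"
          using \<open>t > 0\<close> by (simp add: power2_eq_square mult_left_le)
        \<comment> \<open>Since \<open>1 - t \<le> 1 - t^2 = |w|^2 < r^2 * C\<close>, the defect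
          \<open>1 - t\<close> is quadratic in \<open>r\<close> and remains small after division by
          \<open>r\<close>.\<close>
        ultimately have "(1 - t) / r < r * C"
          using r by (simp add: divide_less_eq power2_eq_square mult_ac)
        then have "cmod (complex_of_real ((1 - t) / r)) < \<delta>"
          using small r t1 by (simp only: norm_of_real) (simp add: r_def mult.commute)
        then have "hopf_map \<xi> h (v, complex_of_real ((1 - t) / r)) \<in> W"
          using inW[OF y(1) u] v by simp
        also have "(v, complex_of_real ((1 - t) / r)) =
            (smul \<xi> (complex_of_real (1 / r)) w, complex_of_real (1 / r) * complex_of_real (1 - t))"
          by (simp add: v_def)
        also have "hopf_map \<xi> h \<dots> = (w, t)"
          using hopf_map_smul[OF w(1), of "complex_of_real (1 / r)"] r hopf_map_section(2)[OF wt \<open>t \<noteq> 1\<close>]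
          by simp
        finally show ?thesis .
      qed
    qed
  qed
qed

section \<open>Surjectivity and the quotient property\<close>

lemma topspace_nonzero_vectors_plus_C:
  "topspace (subtopology (total (plus_C \<xi>)) (nonzero_vectors (plus_C \<xi>))) = nonzero_vectors (plus_C \<xi>)"
  by (auto simp: nonzero_vectors_def)

lemma hopf_map_surj:
  "hopf_map \<xi> h ` nonzero_vectors (plus_C \<xi>) = topspace (sph_compactification \<xi> h)"
proof
  show "hopf_map \<xi> h ` nonzero_vectors (plus_C \<xi>) \<subseteq> topspace (sph_compactification \<xi> h)"
    using hopf_map_in_sph_compactification by auto
  show "topspace (sph_compactification \<xi> h) \<subseteq> hopf_map \<xi> h ` nonzero_vectors (plus_C \<xi>)"
  proof (rule subrelI)
    fix w t assume wt: "(w, t) \<in> topspace (sph_compactification \<xi> h)"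
    show "(w, t) \<in> hopf_map \<xi> h ` nonzero_vectors (plus_C \<xi>)"
    proof (cases "t = 1")
      case True
      have w: "w \<in> topspace (total \<xi>)" "w = vzero \<xi> (proj \<xi> w)"
        using wt True sph_compactification_pole[of w t] by (auto simp: mem_sph_compactification)
      obtain U \<phi> \<psi> where U: "proj \<xi> w \<in> U" and chart: "chart U \<phi> \<psi>"
        using obtain_chart[OF proj_in_base[OF w(1)]] .
      \<comment> \<open>Here \<open>1\<close> is the all-ones vector, nonzero because the rank is
        positive; the pole is hit only by vectors \<open>(v, 0)\<close> with \<open>v\<close>
        nonzero.\<close>
      define v where "v = \<psi> (proj \<xi> w, 1)"
      have v: "v \<in> topspace (total \<xi>)" "proj \<xi> v = proj \<xi> w" "v \<noteq> vzero \<xi> (proj \<xi> w)"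
        unfolding v_def using chart_inverse_in_total[OF chart U] chart_proj_inverse[OF chart U]
          chart_inverse_nonzero[OF chart U, of 1] by (auto simp: vec_eq_iff)
      have "hopf_map \<xi> h (v, 0) = (w, t)"
        using hopf_map_zero[of v] v w(2) True by simp
      moreover have "(v, 0) \<in> nonzero_vectors (plus_C \<xi>)"
        using v by simp
      ultimately show ?thesis
        by (rule image_eqI[OF sym])
    next
      case False
      then show ?thesis
        using hopf_map_section[OF wt] by (intro image_eqI[OF sym])
    qed
  qed
qed

lemma quotient_map_hopf_map:
  "quotient_map (subtopology (total (plus_C \<xi>)) (nonzero_vectors (plus_C \<xi>)))
    (sph_compactification \<xi> h) (hopf_map \<xi> h)"
proof -
  let ?Z = "subtopology (total (plus_C \<xi>)) (nonzero_vectors (plus_C \<xi>))"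
  let ?S = "sph_compactification \<xi> h"
  define S' where "S' = {z \<in> topspace ?S. snd z \<in> - {1}}"
  have "continuous_map ?S euclideanreal snd" and fst: "continuous_map ?S (total \<xi>) fst"
    unfolding sph_compactification_def
    by (intro continuous_map_from_subtopology continuous_map_snd continuous_map_fst)+
  then have S': "openin ?S S'"
    unfolding S'_def by (intro openin_continuous_map_preimage[where Y = euclideanreal]) auto
  have snd: "continuous_map (subtopology ?S S') euclideanreal snd"
    using \<open>continuous_map ?S euclideanreal snd\<close> by (rule continuous_map_from_subtopology)
  have "continuous_map (subtopology ?S S') (total (plus_C \<xi>)) (\<lambda>z. (fst z, complex_of_real (1 - snd z)))"
    unfolding total_plus_C
  proof (rule continuous_map_pairedI)
    show "continuous_map (subtopology ?S S') (total \<xi>) fst"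
      using fst by (rule continuous_map_from_subtopology)
    show "continuous_map (subtopology ?S S') euclidean (\<lambda>z. complex_of_real (1 - snd z))"
      using snd unfolding continuous_map_atin limitin_canonical_iff
      by (intro ballI tendsto_of_real tendsto_diff tendsto_const) auto
  qed
  then have sect: "continuous_map (subtopology ?S S') ?Z (\<lambda>z. (fst z, complex_of_real (1 - snd z)))"
    using hopf_map_section(1) by (intro continuous_map_into_subtopology) (auto simp: S'_def)
  have "openin ?S W"
    if W: "W \<subseteq> topspace ?S" and P: "openin ?Z {z \<in> topspace ?Z. hopf_map \<xi> h z \<in> W}" for W
    unfolding openin_subopen[of _ W]
  proof (intro ballI)
    fix z assume z: "z \<in> W"
    obtain w t where wt: "z = (w, t)"
      by (cases z)
    show "\<exists>T. openin ?S T \<and> z \<in> T \<and> T \<subseteq> W"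
    proof (cases "t = 1")
      case True
      then have "w = vzero \<xi> (proj \<xi> w)" "w \<in> topspace (total \<xi>)"
        using W z sph_compactification_pole[of w t] by (auto simp: wt mem_sph_compactification)
      then have "(vzero \<xi> (proj \<xi> w), 1) = z"
        using True wt by simp
      then show ?thesis
        using hopf_map_neighbourhood_of_pole[OF P proj_in_base[OF \<open>w \<in> topspace (total \<xi>)\<close>]] z by metis
    next
      case False
      let ?T = "{z \<in> topspace (subtopology ?S S').
        (fst z, complex_of_real (1 - snd z)) \<in> {z \<in> topspace ?Z. hopf_map \<xi> h z \<in> W}}"
      have "openin (subtopology ?S S') ?T"
        using sect P by (rule openin_continuous_map_preimage)
      then have "openin ?S ?T"
        using S' by (simp add: openin_open_subtopology)
      \<comment> \<open>As \<open>hopf_map\<close> undoes the section, pulling the preimage of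
        \<open>W\<close> back along the section returns \<open>W\<close> away from the pole.\<close>
      moreover have "?T = W \<inter> S'"
        using W hopf_map_section unfolding topspace_nonzero_vectors_plus_C by (auto simp: S'_def)
      ultimately have "openin ?S (W \<inter> S')"
        by simp
      then show ?thesis
        using z False W wt by (intro exI[of _ "W \<inter> S'"]) (auto simp: S'_def)
    qed
  qed
  moreover have "openin ?Z {z \<in> topspace ?Z. hopf_map \<xi> h z \<in> W}" if "openin ?S W" for W
    using continuous_map_hopf_map that by (rule openin_continuous_map_preimage)
  moreover have "hopf_map \<xi> h ` topspace ?Z = topspace ?S"
    unfolding topspace_nonzero_vectors_plus_C by (rule hopf_map_surj)
  ultimately show ?thesis
    unfolding quotient_map_def by blast
qed

section \<open>Lines at infinity and their collapse\<close>

lemma quotient_map_line: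
  "quotient_map (subtopology (total (plus_C \<xi>)) (nonzero_vectors (plus_C \<xi>)))
    (proj_compactification \<xi>) (line (plus_C \<xi>))"
  by (simp only: proj_compactification_def projectivisation_def quotient_map_identification_topology)

lemma topspace_proj_compactification:
  "topspace (proj_compactification \<xi>) = line (plus_C \<xi>) ` nonzero_vectors (plus_C \<xi>)"
  by (simp add: proj_compactification_def plus.topspace_projectivisation)

lemma line_plus_0_line: "line_plus_0 (line \<xi> v) = line (plus_C \<xi>) (v, 0)"
  by (auto simp: line_plus_0_def line_def)

text \<open>Vectors on the same line differ by a nonzero factor, which preserves both the vanishing
  of the second entry and the base point.\<close>

lemma line_in_fibre_at_infinity_iff:
  assumes z: "(v, a) \<in> nonzero_vectors (plus_C \<xi>)"
  shows "line (plus_C \<xi>) (v, a) \<in> fibre_at_infinity \<xi> x \<longleftrightarrow> a = 0 \<and> proj \<xi> v = x"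
proof
  assume "line (plus_C \<xi>) (v, a) \<in> fibre_at_infinity \<xi> x"
  then obtain w where w: "w \<in> nonzero_vectors \<xi>" "proj \<xi> w = x"
    and eq: "line (plus_C \<xi>) (v, a) = line (plus_C \<xi>) (w, 0)"
    by (auto simp: fibre_at_infinity_def projectivisation_fibre_eq line_plus_0_line)
  have "(w, 0) \<in> nonzero_vectors (plus_C \<xi>)"
    using w(1) by (simp add: nonzero_vectors_def)
  then obtain c where "c \<noteq> 0" "(w, 0) = smul (plus_C \<xi>) c (v, a)"
    using plus.line_eq_obtains[OF _ _ eq] z by auto
  then show "a = 0 \<and> proj \<xi> v = x"
    using z w(2) by auto
next
  assume "a = 0 \<and> proj \<xi> v = x"
  then show "line (plus_C \<xi>) (v, a) \<in> fibre_at_infinity \<xi> x"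
    using z by (auto simp: fibre_at_infinity_def projectivisation_fibre_eq nonzero_vectors_def
        simp flip: line_plus_0_line)
qed

lemma fibre_at_infinity_disjoint:
  assumes "y \<in> fibre_at_infinity \<xi> x" "y \<in> fibre_at_infinity \<xi> x'"
  shows "x = x'"
proof -
  obtain v where "v \<in> nonzero_vectors \<xi>" "y = line (plus_C \<xi>) (v, 0)"
    using assms(1) by (auto simp: fibre_at_infinity_def projectivisation_fibre_eq line_plus_0_line)
  then show ?thesis
    using assms line_in_fibre_at_infinity_iff[of v 0] by (simp add: nonzero_vectors_def)
qed

text \<open>The two maps have the same fibres: either side says that the lines agree or that both
  are at infinity over the same base point.\<close>

lemma line_collapse_iff:
  assumes z: "(v, a) \<in> nonzero_vectors (plus_C \<xi>)" and z': "(v', a') \<in> nonzero_vectors (plus_C \<xi>)"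
  shows "collapse_class (proj_compactification \<xi>) (topspace (base \<xi>)) (fibre_at_infinity \<xi>)
           (line (plus_C \<xi>) (v, a)) =
         collapse_class (proj_compactification \<xi>) (topspace (base \<xi>)) (fibre_at_infinity \<xi>)
           (line (plus_C \<xi>) (v', a')) \<longleftrightarrow>
         hopf_map \<xi> h (v, a) = hopf_map \<xi> h (v', a')"
proof -
  have "line (plus_C \<xi>) (v, a) \<in> topspace (proj_compactification \<xi>)"
    "line (plus_C \<xi>) (v', a') \<in> topspace (proj_compactification \<xi>)"
    using z z' by (simp_all only: topspace_proj_compactification imageI)
  moreover have "proj \<xi> v \<in> topspace (base \<xi>)"
    using z by (simp add: proj_in_base)
  ultimately show ?thesis
    unfolding hopf_map_eq_iff[OF z z']
    using line_in_fibre_at_infinity_iff[OF z] line_in_fibre_at_infinity_iff[OF z']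
    by (subst collapse_class_eq_iff[OF fibre_at_infinity_disjoint]) auto
qed

section \<open>Pinching the poles\<close>

lemma sph_compactification_proj_pole:
  "x \<in> topspace (base \<xi>) \<Longrightarrow> z \<in> poles \<xi> x \<Longrightarrow> sph_compactification_proj \<xi> z = x"
  by (auto simp: poles_def sph_compactification_proj_def)

lemma poles_disjoint:
  "x \<in> topspace (base \<xi>) \<Longrightarrow> x' \<in> topspace (base \<xi>) \<Longrightarrow> z \<in> poles \<xi> x \<Longrightarrow> z \<in> poles \<xi> x' \<Longrightarrow> x = x'"
  using sph_compactification_proj_pole by metis

lemma quotient_map_pinch_map:
  "quotient_map (sph_compactification \<xi> h) (pinch_compactification \<xi> h) (pinch_map \<xi> h)"
  unfolding pinch_compactification_def pinch_map_def by (rule quotient_map_collapse_class)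

lemma pinch_map_eq_iff:
  assumes "z \<in> topspace (sph_compactification \<xi> h)" "z' \<in> topspace (sph_compactification \<xi> h)"
  shows "pinch_map \<xi> h z = pinch_map \<xi> h z' \<longleftrightarrow>
    z = z' \<or> (\<exists>x\<in>topspace (base \<xi>). {z, z'} = {(vzero \<xi> x, 1), (vzero \<xi> x, -1)})"
proof -
  have "pinch_map \<xi> h z = pinch_map \<xi> h z' \<longleftrightarrow>
      z = z' \<or> (\<exists>x\<in>topspace (base \<xi>). z \<in> poles \<xi> x \<and> z' \<in> poles \<xi> x)"
    unfolding pinch_map_def by (rule collapse_class_eq_iff[OF poles_disjoint assms])
  \<comment> \<open>Two different members of a two-element set exhaust it.\<close>
  also have "\<dots> \<longleftrightarrow> z = z' \<or> (\<exists>x\<in>topspace (base \<xi>). {z, z'} = {(vzero \<xi> x, 1), (vzero \<xi> x, -1)})"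
    by (auto simp: poles_def doubleton_eq_iff)
  finally show ?thesis .
qed

text \<open>Identified poles lie over the same base point, so the projection is constant on each
  class and its value there is well defined.\<close>

lemma pinch_compactification_proj_pinch_map:
  assumes "z \<in> topspace (sph_compactification \<xi> h)"
  shows "pinch_compactification_proj \<xi> (pinch_map \<xi> h z) = sph_compactification_proj \<xi> z"
proof -
  have "z' = z \<or> (\<exists>x\<in>topspace (base \<xi>). z \<in> poles \<xi> x \<and> z' \<in> poles \<xi> x)"
    if "z' \<in> pinch_map \<xi> h z" for z'
    using that by (auto simp: pinch_map_def collapse_class_def collapse_rel_def)
  then have "sph_compactification_proj \<xi> z' = sph_compactification_proj \<xi> z"
    if "z' \<in> pinch_map \<xi> h z" for z'
    using that sph_compactification_proj_pole by metis
  moreover have "z \<in> pinch_map \<xi> h z"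
    using assms by (simp add: pinch_map_def collapse_class_def collapse_rel_def)
  ultimately show ?thesis
    unfolding pinch_compactification_proj_def by (intro value_on_class_eq) blast
qed

section \<open>Descent to the projective compactification\<close>

lemma hopf_map_incl:
  "v \<in> topspace (total \<xi>) \<Longrightarrow> hopf_map \<xi> h (v, 1) = sph_compactification_incl \<xi> h v"
  by (simp add: hopf_map_def sph_compactification_incl_def)

lemma proj_compactification_proj_line:
  "(v, a) \<in> nonzero_vectors (plus_C \<xi>) \<Longrightarrow>
    proj_compactification_proj \<xi> (line (plus_C \<xi>) (v, a)) = proj \<xi> v"
  unfolding proj_compactification_proj_def by (subst plus.projectivisation_proj_line) auto

text \<open>Since \<open>line\<close> is a quotient map, \<open>p\<close> is one exactly when
  \<open>p \<circ> line\<close> is; the quotient property of \<open>hopf_map\<close> thus descends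
  to lines.\<close>

lemma hopf_map_factors_through_line:
  obtains p where "quotient_map (proj_compactification \<xi>) (sph_compactification \<xi> h) p"
    "\<forall>z\<in>nonzero_vectors (plus_C \<xi>). p (line (plus_C \<xi>) z) = hopf_map \<xi> h z"
proof -
  let ?Z = "subtopology (total (plus_C \<xi>)) (nonzero_vectors (plus_C \<xi>))"
  have "hopf_map \<xi> h z = hopf_map \<xi> h z'"
    if "z \<in> topspace ?Z" "z' \<in> topspace ?Z" "line (plus_C \<xi>) z = line (plus_C \<xi>) z'" for z z'
    using that hopf_map_eq_iff unfolding topspace_nonzero_vectors_plus_C by (cases z; cases z') blast
  then obtain p where p: "continuous_map (proj_compactification \<xi>) (sph_compactification \<xi> h) p"
    "\<And>z. z \<in> topspace ?Z \<Longrightarrow> p (line (plus_C \<xi>) z) = hopf_map \<xi> h z"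
    using quotient_map_lift_exists[OF quotient_map_line continuous_map_hopf_map] by metis
  have "quotient_map ?Z (sph_compactification \<xi> h) (p \<circ> line (plus_C \<xi>))"
    by (rule quotient_map_eq[OF quotient_map_hopf_map]) (simp only: o_apply p(2))
  then have "quotient_map (proj_compactification \<xi>) (sph_compactification \<xi> h) p"
    by (simp only: quotient_map_compose_eq[OF quotient_map_line])
  then show thesis
    using that p(2) unfolding topspace_nonzero_vectors_plus_C by blast
qed

end

theorem proposition3p2:
  fixes \<xi> :: "('e, 'x) cbundle" and h :: "'e \<Rightarrow> 'e \<Rightarrow> complex"
  assumes "complex_vector_bundle TYPE('n::finite) \<xi>"
    and "hermitian_metric \<xi> h"
  shows "\<exists>p q.
    continuous_map (proj_compactification \<xi>) (sph_compactification \<xi> h) p \<and>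
    continuous_map (sph_compactification \<xi> h) (pinch_compactification \<xi> h) q \<and>
    (\<forall>y\<in>topspace (proj_compactification \<xi>).
       sph_compactification_proj \<xi> (p y) = proj_compactification_proj \<xi> y) \<and>
    (\<forall>z\<in>topspace (sph_compactification \<xi> h).
       pinch_compactification_proj \<xi> (q z) = sph_compactification_proj \<xi> z) \<and>
    (\<forall>v\<in>topspace (total \<xi>).
       p (proj_compactification_incl \<xi> v) = sph_compactification_incl \<xi> h v) \<and>
    (\<forall>v\<in>topspace (total \<xi>).
       q (sph_compactification_incl \<xi> h v) = pinch_compactification_incl \<xi> h v) \<and>
    (\<exists>p'. homeomorphic_map
            (collapse_space (proj_compactification \<xi>) (topspace (base \<xi>)) (fibre_at_infinity \<xi>))
            (sph_compactification \<xi> h) p' \<and>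
          (\<forall>y\<in>topspace (proj_compactification \<xi>).
             p' (collapse_class (proj_compactification \<xi>) (topspace (base \<xi>))
                   (fibre_at_infinity \<xi>) y) = p y)) \<and>
    (\<forall>z\<in>topspace (sph_compactification \<xi> h). q z = pinch_map \<xi> h z) \<and>
    quotient_map (sph_compactification \<xi> h) (pinch_compactification \<xi> h) q \<and>
    (\<forall>z\<in>topspace (sph_compactification \<xi> h). \<forall>z'\<in>topspace (sph_compactification \<xi> h).
       q z = q z' \<longleftrightarrow>
         z = z' \<or> (\<exists>x\<in>topspace (base \<xi>).
                     {z, z'} = {(vzero \<xi> x, 1), (vzero \<xi> x, -1)}))"
proof -
  interpret hermitian_bundle \<xi> h "TYPE('n)"
    using assms by unfold_locales
  obtain p where p: "quotient_map (proj_compactification \<xi>) (sph_compactification \<xi> h) p"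
    and p_line: "\<forall>z\<in>nonzero_vectors (plus_C \<xi>). p (line (plus_C \<xi>) z) = hopf_map \<xi> h z"
    using hopf_map_factors_through_line .
  have lines: "\<exists>v a. (v, a) \<in> nonzero_vectors (plus_C \<xi>) \<and> y = line (plus_C \<xi>) (v, a)"
    if "y \<in> topspace (proj_compactification \<xi>)" for y
    using that unfolding topspace_proj_compactification by force
  let ?class = "collapse_class (proj_compactification \<xi>) (topspace (base \<xi>)) (fibre_at_infinity \<xi>)"
  \<comment> \<open>Both \<open>?class\<close> and \<open>p\<close> are quotient maps on the
    projective compactification, so equality of their fibres is all that the homeomorphism
    requires.\<close>
  have "?class y = ?class y' \<longleftrightarrow> p y = p y'"
    if "y \<in> topspace (proj_compactification \<xi>)" "y' \<in> topspace (proj_compactification \<xi>)" for y y'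
    using lines[OF that(1)] lines[OF that(2)] line_collapse_iff p_line by metis
  then obtain p' where p': "homeomorphic_map
      (collapse_space (proj_compactification \<xi>) (topspace (base \<xi>)) (fibre_at_infinity \<xi>))
      (sph_compactification \<xi> h) p'"
    "\<And>y. y \<in> topspace (proj_compactification \<xi>) \<Longrightarrow> p' (?class y) = p y"
    using quotient_maps_same_fibres_homeomorphic[OF quotient_map_collapse_class p] by metis
  have proj: "sph_compactification_proj \<xi> (p y) = proj_compactification_proj \<xi> y"
    if y: "y \<in> topspace (proj_compactification \<xi>)" for y
  proof -
    obtain v a where va: "(v, a) \<in> nonzero_vectors (plus_C \<xi>)" "y = line (plus_C \<xi>) (v, a)"
      using lines[OF y] by blast
    then show ?thesis
      using proj_hopf_map[of v a] bspec[OF p_line va(1)]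
      by (simp add: proj_compactification_proj_line sph_compactification_proj_def case_prod_unfold
          del: mem_nonzero_vectors_plus_C) simp
  qed
  have incl: "p (proj_compactification_incl \<xi> v) = sph_compactification_incl \<xi> h v"
    if "v \<in> topspace (total \<xi>)" for v
    using that bspec[OF p_line, of "(v, 1)"] by (simp add: proj_compactification_incl_def hopf_map_incl)
  show ?thesis
  proof (intro exI[of _ p] exI[of _ "pinch_map \<xi> h"] exI[of _ p'] conjI ballI)
    show "continuous_map (proj_compactification \<xi>) (sph_compactification \<xi> h) p"
      using p by (rule quotient_imp_continuous_map)
    show "continuous_map (sph_compactification \<xi> h) (pinch_compactification \<xi> h) (pinch_map \<xi> h)"
      using quotient_map_pinch_map by (rule quotient_imp_continuous_map)
  qed (simp_all add: p' proj incl quotient_map_pinch_map pinch_compactification_proj_pinch_map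
      pinch_map_eq_iff pinch_compactification_incl_def)
qed

end
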